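(* Let $A = B \times H$ be a biproduct over a field $k$ and let $F \in \mathrm{End}_{\mathrm{Hopf}}(A, \pi)$. Then: (a) $F_L : B \to B$ is an algebra endomorphism. (b) $\epsilon \circ F_L = \epsilon$. (c) $\Delta(F_L(b)) = F_L(b_{(1)})F_R(b_{(2)(-1)}) \otimes F_L(b_{(2)(0)})$ for all $b \in B$. (d) $\rho(F_L(b)) = b_{(-1)} \otimes F_L(b_{(0)})$ for all $b \in B$. (e) $F_L(h_{(1)}\cdot b)F_R(h_{(2)}) = F_R(h_{(1)})(h_{(2)}\cdot F_L(b))$ for all $h \in H$ and $b \in B$.
   Context: Let $k$ be a field and $H$ a Hopf algebra over $k$. Sweedler notation: $\Delta(c) = c_{(1)} \otimes c_{(2)}$; for a left $H$-comodule $(M,\rho)$, $\rho(m) = m_{(-1)} \otimes m_{(0)} \in H \otimes M$. Biproduct. $B$ is a vector space which is an algebra, a coalgebra, a left $H$-module and a left $H$-comodule over $k$, such that: $B$ is a left $H$-module algebra, left $H$-module coalgebra, left $H$-comodule algebra, and left $H$-comodule coalgebra ($b_{(-1)}\epsilon(b_{(0)}) = \epsilon(b)1$, $b_{(1)(-1)}b_{(2)(-1)} \otimes b_{(1)(0)} \otimes b_{(2)(0)} = b_{(-1)} \otimes b_{(0)(1)} \otimes b_{(0)(2)}$); $\epsilon : B \to k$ is an algebra map and $\Delta(1) = 1 \otimes 1$; $\Delta(bb') = b_{(1)}(b_{(2)(-1)}\cdot b'_{(1)}) \otimes b_{(2)(0)}b'_{(2)}$; $h_{(1)}b_{(-1)}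 \otimes h_{(2)}\cdot b_{(0)} = (h_{(1)}\cdot b)_{(-1)}h_{(2)} \otimes (h_{(1)}\cdot b)_{(0)}$; and $\mathrm{Id}_B$ has a convolution inverse. (Equivalently, $B$ is a Hopf algebra in ${}_H^H\mathcal{YD}$.) The biproduct $A = B \times H$ is the Hopf algebra over $k$ with underlying space $B \otimes H$ (tensors written $b \times h$), product $(b \times h)(b' \times h') = b(h_{(1)}\cdot b') \times h_{(2)}h'$, unit $1 \times 1$, coproduct $\Delta(b \times h) = (b_{(1)} \times b_{(2)(-1)}h_{(1)}) \otimes (b_{(2)(0)} \times h_{(2)})$ and counit $\epsilon \otimes \epsilon$. Maps: $\pi : A \to H$, $\pi(b \times h) = \epsilon(b)h$; $j : H \to A$, $j(h) = 1 \times h$; $\Pi : A \to B$, $\Pi(b \times h) = b\epsilon(h)$; $J : B \to A$, $J(b) = b \times 1$. $\mathrm{End}_{\mathrm{Hopf}}(A, \pi)$ is the set of Hopf algebra endomorphisms $F$ of $A$ with $\pi \circ F = \pi$. For such $F$, $F_L = \Pi \circ F \circ J : B \to B$ and $F_R = \Pi \circ F \circ j : H \to B$. *)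

theory Defs
  imports "HOL-Algebra.Module"
begin

section \<open>Tensor products over a field\<close>

text \<open>
  Vector spaces and algebras over \<open>K\<close> are records of type \<^typ>\<open>('k, 'v) module\<close>.
  The tensor product of \<open>V\<close> and \<open>W\<close> is the quotient of the formal sums of pairs, written as lists,
  by the congruence generated by bilinearity. Commutativity has to be imposed because formal sums
  are lists, and \<open>zero\<close> identifies the empty sum with \<open>0 \<otimes> w\<close>. Additive inverses are then
  automatic.
\<close>

type_synonym ('v, 'w) tensor = "('v \<times> 'w) list set"

inductive tensor_eq ::
  "('k, 'm) ring_scheme \<Rightarrow> ('k, 'v, 'p) module_scheme \<Rightarrow> ('k, 'w, 'q) module_scheme \<Rightarrow>
    ('v \<times> 'w) list \<Rightarrow> ('v \<times> 'w) list \<Rightarrow> bool"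
  for K V W
where
  refl: "set x \<subseteq> carrier V \<times> carrier W \<Longrightarrow> tensor_eq K V W x x"
| sym: "tensor_eq K V W x y \<Longrightarrow> tensor_eq K V W y x"
| trans: "tensor_eq K V W x y \<Longrightarrow> tensor_eq K V W y z \<Longrightarrow> tensor_eq K V W x z"
| append: "tensor_eq K V W x x' \<Longrightarrow> tensor_eq K V W y y' \<Longrightarrow> tensor_eq K V W (x @ y) (x' @ y')"
| commute: "set x \<subseteq> carrier V \<times> carrier W \<Longrightarrow> set y \<subseteq> carrier V \<times> carrier W \<Longrightarrow>
    tensor_eq K V W (x @ y) (y @ x)"
| zero: "w \<in> carrier W \<Longrightarrow> tensor_eq K V W [(\<zero>\<^bsub>V\<^esub>, w)] []"
| add_left: "v \<in> carrier V \<Longrightarrow> v' \<in> carrier V \<Longrightarrow> w \<in> carrier W \<Longrightarrow>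
    tensor_eq K V W [(v \<oplus>\<^bsub>V\<^esub> v', w)] [(v, w), (v', w)]"
| add_right: "v \<in> carrier V \<Longrightarrow> w \<in> carrier W \<Longrightarrow> w' \<in> carrier W \<Longrightarrow>
    tensor_eq K V W [(v, w \<oplus>\<^bsub>W\<^esub> w')] [(v, w), (v, w')]"
| smult: "c \<in> carrier K \<Longrightarrow> v \<in> carrier V \<Longrightarrow> w \<in> carrier W \<Longrightarrow>
    tensor_eq K V W [(c \<odot>\<^bsub>V\<^esub> v, w)] [(v, c \<odot>\<^bsub>W\<^esub> w)]"

definition tensor_class ::
  "('k, 'm) ring_scheme \<Rightarrow> ('k, 'v, 'p) module_scheme \<Rightarrow> ('k, 'w, 'q) module_scheme \<Rightarrow>
    ('v \<times> 'w) list \<Rightarrow> ('v, 'w) tensor"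
  where "tensor_class K V W x = {y. tensor_eq K V W x y}"

definition tensor_rep :: "('v, 'w) tensor \<Rightarrow> ('v \<times> 'w) list"
  where "tensor_rep X = (SOME x. x \<in> X)"

text \<open>
  The fields \<open>mult\<close> and \<open>one\<close> are the usual algebra structure of the tensor product when
  \<open>V\<close> and \<open>W\<close> are algebras; otherwise they are irrelevant.
\<close>

definition tensor ::
  "('k, 'm) ring_scheme \<Rightarrow> ('k, 'v, 'p) module_scheme \<Rightarrow> ('k, 'w, 'q) module_scheme \<Rightarrow>
    ('k, ('v, 'w) tensor) module"
  where "tensor K V W =
   \<lparr>carrier = tensor_class K V W ` {x. set x \<subseteq> carrier V \<times> carrier W},
    mult = (\<lambda>X Y. tensor_class K V W
      [(v \<otimes>\<^bsub>V\<^esub> v', w \<otimes>\<^bsub>W\<^esub> w'). (v, w) \<leftarrow> tensor_rep X, (v', w') \<leftarrow> tensor_rep Y]),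
    one = tensor_class K V W [(\<one>\<^bsub>V\<^esub>, \<one>\<^bsub>W\<^esub>)],
    zero = tensor_class K V W [],
    add = (\<lambda>X Y. tensor_class K V W (tensor_rep X @ tensor_rep Y)),
    smult = (\<lambda>c X. tensor_class K V W [(c \<odot>\<^bsub>V\<^esub> v, w). (v, w) \<leftarrow> tensor_rep X])\<rparr>"

definition pure ::
  "('k, 'm) ring_scheme \<Rightarrow> ('k, 'v, 'p) module_scheme \<Rightarrow> ('k, 'w, 'q) module_scheme \<Rightarrow>
    'v \<Rightarrow> 'w \<Rightarrow> ('v, 'w) tensor"
  where "pure K V W v w = tensor_class K V W [(v, w)]"

text \<open>
  For a bilinear map \<open>\<beta>\<close> into \<open>U\<close>, \<open>tsum U X \<beta>\<close> is the value at \<open>X\<close> of the linear map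
  induced by \<open>\<beta>\<close>. Sweedler notation is written with it: the sum of
  \<open>\<beta> c\<^sub>(\<^sub>1\<^sub>) c\<^sub>(\<^sub>2\<^sub>)\<close> is \<open>tsum U (comult C c) (\<lambda>c1 c2. \<beta> c1 c2)\<close>.
\<close>

definition tsum ::
  "('k, 'u, 'r) module_scheme \<Rightarrow> ('v, 'w) tensor \<Rightarrow> ('v \<Rightarrow> 'w \<Rightarrow> 'u) \<Rightarrow> 'u"
  where "tsum U X \<beta> = foldr (\<lambda>(v, w) s. \<beta> v w \<oplus>\<^bsub>U\<^esub> s) (tensor_rep X) \<zero>\<^bsub>U\<^esub>"


section \<open>Linear maps, algebras, coalgebras and Hopf algebras\<close>

definition base :: "('k, 'm) ring_scheme \<Rightarrow> ('k, 'k) module"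
  where "base K = \<lparr>carrier = carrier K, mult = mult K, one = one K, zero = zero K, add = add K,
    smult = mult K\<rparr>"

definition linear_maps ::
  "('k, 'm) ring_scheme \<Rightarrow> ('k, 'v, 'p) module_scheme \<Rightarrow> ('k, 'w, 'q) module_scheme \<Rightarrow>
    ('v \<Rightarrow> 'w) set"
  where "linear_maps K V W = {f. f \<in> carrier V \<rightarrow> carrier W \<and>
    (\<forall>x \<in> carrier V. \<forall>y \<in> carrier V. f (x \<oplus>\<^bsub>V\<^esub> y) = f x \<oplus>\<^bsub>W\<^esub> f y) \<and>
    (\<forall>c \<in> carrier K. \<forall>x \<in> carrier V. f (c \<odot>\<^bsub>V\<^esub> x) = c \<odot>\<^bsub>W\<^esub> f x)}"

definition algebra_maps ::
  "('k, 'm) ring_scheme \<Rightarrow> ('k, 'v, 'p) module_scheme \<Rightarrow> ('k, 'w, 'q) module_scheme \<Rightarrow>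
    ('v \<Rightarrow> 'w) set"
  where "algebra_maps K A A' = ring_hom A A' \<inter> linear_maps K A A'"

definition bilinear_maps ::
  "('k, 'm) ring_scheme \<Rightarrow> ('k, 'v, 'p) module_scheme \<Rightarrow> ('k, 'w, 'q) module_scheme \<Rightarrow>
    ('k, 'u, 'r) module_scheme \<Rightarrow> ('v \<Rightarrow> 'w \<Rightarrow> 'u) set"
  where "bilinear_maps K V W U = {\<beta>.
    (\<forall>v \<in> carrier V. \<beta> v \<in> linear_maps K W U) \<and>
    (\<forall>w \<in> carrier W. (\<lambda>v. \<beta> v w) \<in> linear_maps K V U)}"

record ('k, 'a) coalg = "('k, 'a) module" +
  comult :: "'a \<Rightarrow> ('a, 'a) tensor"
  counit :: "'a \<Rightarrow> 'k"

text \<open>The library locale \<^locale>\<open>algebra\<close> is restricted to commutative algebras.\<close>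

locale k_algebra = field K + module K A + ring A for K (structure) and A (structure) +
  assumes smult_mult_left: "\<lbrakk>c \<in> carrier K; x \<in> carrier A; y \<in> carrier A\<rbrakk> \<Longrightarrow>
      (c \<odot>\<^bsub>A\<^esub> x) \<otimes>\<^bsub>A\<^esub> y = c \<odot>\<^bsub>A\<^esub> (x \<otimes>\<^bsub>A\<^esub> y)"
    and smult_mult_right: "\<lbrakk>c \<in> carrier K; x \<in> carrier A; y \<in> carrier A\<rbrakk> \<Longrightarrow>
      x \<otimes>\<^bsub>A\<^esub> (c \<odot>\<^bsub>A\<^esub> y) = c \<odot>\<^bsub>A\<^esub> (x \<otimes>\<^bsub>A\<^esub> y)"

locale k_coalgebra = field K + module K C for K (structure) and C (structure) +
  assumes comult_linear: "comult C \<in> linear_maps K C (tensor K C C)"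
    and counit_linear: "counit C \<in> linear_maps K C (base K)"
    and coassoc: "c \<in> carrier C \<Longrightarrow>
      tsum (tensor K C (tensor K C C)) (comult C c) (\<lambda>c1 c2.
        tsum (tensor K C (tensor K C C)) (comult C c1) (\<lambda>c11 c12.
          pure K C (tensor K C C) c11 (pure K C C c12 c2))) =
      tsum (tensor K C (tensor K C C)) (comult C c) (\<lambda>c1 c2.
        pure K C (tensor K C C) c1 (comult C c2))"
    and counit_left: "c \<in> carrier C \<Longrightarrow>
      tsum C (comult C c) (\<lambda>c1 c2. counit C c1 \<odot>\<^bsub>C\<^esub> c2) = c"
    and counit_right: "c \<in> carrier C \<Longrightarrow>
      tsum C (comult C c) (\<lambda>c1 c2. counit C c2 \<odot>\<^bsub>C\<^esub> c1) = c"

text \<open>\<open>S\<close> is an inverse of the identity in the convolution algebra of linear endomorphisms.\<close>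

definition conv_inverse_id ::
  "('k, 'm) ring_scheme \<Rightarrow> ('k, 'a, 'p) coalg_scheme \<Rightarrow> ('a \<Rightarrow> 'a) \<Rightarrow> bool"
  where "conv_inverse_id K A S \<longleftrightarrow> S \<in> linear_maps K A A \<and>
    (\<forall>a \<in> carrier A. tsum A (comult A a) (\<lambda>a1 a2. S a1 \<otimes>\<^bsub>A\<^esub> a2) = counit A a \<odot>\<^bsub>A\<^esub> \<one>\<^bsub>A\<^esub>) \<and>
    (\<forall>a \<in> carrier A. tsum A (comult A a) (\<lambda>a1 a2. a1 \<otimes>\<^bsub>A\<^esub> S a2) = counit A a \<odot>\<^bsub>A\<^esub> \<one>\<^bsub>A\<^esub>)"

locale hopf_algebra = k_algebra K H + k_coalgebra K H for K (structure) and H (structure) +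
  assumes comult_algebra_map: "comult H \<in> algebra_maps K H (tensor K H H)"
    and counit_algebra_map: "counit H \<in> algebra_maps K H (base K)"
    and antipode: "\<exists>S. conv_inverse_id K H S"

text \<open>
  Hopf algebra maps are the algebra maps that are coalgebra maps; such maps commute with the
  antipodes.
\<close>

definition hopf_maps ::
  "('k, 'm) ring_scheme \<Rightarrow> ('k, 'a, 'p) coalg_scheme \<Rightarrow> ('k, 'b, 'q) coalg_scheme \<Rightarrow>
    ('a \<Rightarrow> 'b) set"
  where "hopf_maps K A A' = {f \<in> algebra_maps K A A'.
    (\<forall>a \<in> carrier A. comult A' (f a) =
      tsum (tensor K A' A') (comult A a) (\<lambda>a1 a2. pure K A' A' (f a1) (f a2))) \<and>
    (\<forall>a \<in> carrier A. counit A' (f a) = counit A a)}"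


section \<open>Actions and coactions of a Hopf algebra\<close>

text \<open>
  In the locales below \<open>act h b\<close> is \<open>h \<cdot> b\<close>. Variables \<open>bm\<close>, \<open>b0\<close> stand for the
  Sweedler components in \<open>H\<close> and \<open>B\<close> of \<open>coact b\<close>.
\<close>

locale left_module = hopf_algebra K H + M: module K B
  for K (structure) and H (structure) and B (structure) +
  fixes act :: "'h \<Rightarrow> 'b \<Rightarrow> 'b"
  assumes act_bilinear: "act \<in> bilinear_maps K H B B"
    and act_one: "b \<in> carrier B \<Longrightarrow> act \<one>\<^bsub>H\<^esub> b = b"
    and act_mult: "\<lbrakk>h \<in> carrier H; h' \<in> carrier H; b \<in> carrier B\<rbrakk> \<Longrightarrow>
      act (h \<otimes>\<^bsub>H\<^esub> h') b = act h (act h' b)"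

locale left_comodule = hopf_algebra K H + M: module K B
  for K (structure) and H (structure) and B (structure) +
  fixes coact :: "'b \<Rightarrow> ('h, 'b) tensor"
  assumes coact_linear: "coact \<in> linear_maps K B (tensor K H B)"
    and coact_coassoc: "b \<in> carrier B \<Longrightarrow>
      tsum (tensor K H (tensor K H B)) (coact b) (\<lambda>bm b0.
        tsum (tensor K H (tensor K H B)) (comult H bm) (\<lambda>bm1 bm2.
          pure K H (tensor K H B) bm1 (pure K H B bm2 b0))) =
      tsum (tensor K H (tensor K H B)) (coact b) (\<lambda>bm b0.
        pure K H (tensor K H B) bm (coact b0))"
    and coact_counit: "b \<in> carrier B \<Longrightarrow>
      tsum B (coact b) (\<lambda>bm b0. counit H bm \<odot>\<^bsub>B\<^esub> b0) = b"

locale module_algebra = left_module K H B act + B: k_algebra K B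
  for K (structure) and H (structure) and B (structure) and act +
  assumes act_algebra_mult: "\<lbrakk>h \<in> carrier H; b \<in> carrier B; b' \<in> carrier B\<rbrakk> \<Longrightarrow>
      act h (b \<otimes>\<^bsub>B\<^esub> b') = tsum B (comult H h) (\<lambda>h1 h2. act h1 b \<otimes>\<^bsub>B\<^esub> act h2 b')"
    and act_algebra_one: "h \<in> carrier H \<Longrightarrow> act h \<one>\<^bsub>B\<^esub> = counit H h \<odot>\<^bsub>B\<^esub> \<one>\<^bsub>B\<^esub>"

locale module_coalgebra = left_module K H B act + B: k_coalgebra K B
  for K (structure) and H (structure) and B (structure) and act +
  assumes act_comult: "\<lbrakk>h \<in> carrier H; b \<in> carrier B\<rbrakk> \<Longrightarrow>
      comult B (act h b) =
      tsum (tensor K B B) (comult H h) (\<lambda>h1 h2.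
        tsum (tensor K B B) (comult B b) (\<lambda>b1 b2. pure K B B (act h1 b1) (act h2 b2)))"
    and act_counit: "\<lbrakk>h \<in> carrier H; b \<in> carrier B\<rbrakk> \<Longrightarrow>
      counit B (act h b) = counit H h \<otimes>\<^bsub>K\<^esub> counit B b"

locale comodule_algebra = left_comodule K H B coact + B: k_algebra K B
  for K (structure) and H (structure) and B (structure) and coact +
  assumes coact_algebra_map: "coact \<in> algebra_maps K B (tensor K H B)"

locale comodule_coalgebra = left_comodule K H B coact + B: k_coalgebra K B
  for K (structure) and H (structure) and B (structure) and coact +
  assumes coact_comult: "b \<in> carrier B \<Longrightarrow>
      tsum (tensor K H (tensor K B B)) (comult B b) (\<lambda>b1 b2.
        tsum (tensor K H (tensor K B B)) (coact b1) (\<lambda>b1m b10.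
          tsum (tensor K H (tensor K B B)) (coact b2) (\<lambda>b2m b20.
            pure K H (tensor K B B) (b1m \<otimes>\<^bsub>H\<^esub> b2m) (pure K B B b10 b20)))) =
      tsum (tensor K H (tensor K B B)) (coact b) (\<lambda>bm b0.
        pure K H (tensor K B B) bm (comult B b0))"
    and coact_counit_comodule: "b \<in> carrier B \<Longrightarrow>
      tsum H (coact b) (\<lambda>bm b0. counit B b0 \<odot>\<^bsub>H\<^esub> bm) = counit B b \<odot>\<^bsub>H\<^esub> \<one>\<^bsub>H\<^esub>"


section \<open>Biproducts\<close>

locale biproduct_data =
    module_algebra K H B act + module_coalgebra K H B act +
    comodule_algebra K H B coact + comodule_coalgebra K H B coact
  for K (structure) and H (structure) and B (structure) and act and coact +
  assumes counit_B_algebra_map: "counit B \<in> algebra_maps K B (base K)"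
    and comult_B_one: "comult B \<one>\<^bsub>B\<^esub> = pure K B B \<one>\<^bsub>B\<^esub> \<one>\<^bsub>B\<^esub>"
    and comult_B_mult: "\<lbrakk>b \<in> carrier B; b' \<in> carrier B\<rbrakk> \<Longrightarrow>
      comult B (b \<otimes>\<^bsub>B\<^esub> b') =
      tsum (tensor K B B) (comult B b) (\<lambda>b1 b2.
        tsum (tensor K B B) (comult B b') (\<lambda>b'1 b'2.
          tsum (tensor K B B) (coact b2) (\<lambda>b2m b20.
            pure K B B (b1 \<otimes>\<^bsub>B\<^esub> act b2m b'1) (b20 \<otimes>\<^bsub>B\<^esub> b'2))))"
    and yetter_drinfeld: "\<lbrakk>h \<in> carrier H; b \<in> carrier B\<rbrakk> \<Longrightarrow>
      tsum (tensor K H B) (comult H h) (\<lambda>h1 h2.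
        tsum (tensor K H B) (coact b) (\<lambda>bm b0. pure K H B (h1 \<otimes>\<^bsub>H\<^esub> bm) (act h2 b0))) =
      tsum (tensor K H B) (comult H h) (\<lambda>h1 h2.
        tsum (tensor K H B) (coact (act h1 b)) (\<lambda>cm c0. pure K H B (cm \<otimes>\<^bsub>H\<^esub> h2) c0))"
    and antipode_B: "\<exists>S. conv_inverse_id K B S"

definition biproduct ::
  "('k, 'm) ring_scheme \<Rightarrow> ('k, 'h, 'p) coalg_scheme \<Rightarrow> ('k, 'b, 'q) coalg_scheme \<Rightarrow>
    ('h \<Rightarrow> 'b \<Rightarrow> 'b) \<Rightarrow> ('b \<Rightarrow> ('h, 'b) tensor) \<Rightarrow> ('k, ('b, 'h) tensor) coalg"
  where "biproduct K H B act coact = (let T = tensor K B H; TT = tensor K T T in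
   \<lparr>carrier = carrier T,
    mult = (\<lambda>X Y. tsum T X (\<lambda>b h. tsum T Y (\<lambda>b' h'.
      tsum T (comult H h) (\<lambda>h1 h2. pure K B H (b \<otimes>\<^bsub>B\<^esub> act h1 b') (h2 \<otimes>\<^bsub>H\<^esub> h'))))),
    one = pure K B H \<one>\<^bsub>B\<^esub> \<one>\<^bsub>H\<^esub>,
    zero = zero T,
    add = add T,
    smult = smult T,
    comult = (\<lambda>X. tsum TT X (\<lambda>b h.
      tsum TT (comult B b) (\<lambda>b1 b2. tsum TT (coact b2) (\<lambda>b2m b20.
        tsum TT (comult H h) (\<lambda>h1 h2.
          pure K T T (pure K B H b1 (b2m \<otimes>\<^bsub>H\<^esub> h1)) (pure K B H b20 h2)))))),
    counit = (\<lambda>X. tsum (base K) X (\<lambda>b h. counit B b \<otimes>\<^bsub>K\<^esub> counit H h))\<rparr>)"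

definition proj_H :: "('k, 'h, 'p) coalg_scheme \<Rightarrow> ('k, 'b, 'q) coalg_scheme \<Rightarrow> ('b, 'h) tensor \<Rightarrow> 'h"
  where "proj_H H B X = tsum H X (\<lambda>b h. counit B b \<odot>\<^bsub>H\<^esub> h)"

definition inj_H ::
  "('k, 'm) ring_scheme \<Rightarrow> ('k, 'h, 'p) coalg_scheme \<Rightarrow> ('k, 'b, 'q) coalg_scheme \<Rightarrow>
    'h \<Rightarrow> ('b, 'h) tensor"
  where "inj_H K H B h = pure K B H \<one>\<^bsub>B\<^esub> h"

definition proj_B :: "('k, 'h, 'p) coalg_scheme \<Rightarrow> ('k, 'b, 'q) coalg_scheme \<Rightarrow> ('b, 'h) tensor \<Rightarrow> 'b"
  where "proj_B H B X = tsum B X (\<lambda>b h. counit H h \<odot>\<^bsub>B\<^esub> b)"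

definition inj_B ::
  "('k, 'm) ring_scheme \<Rightarrow> ('k, 'h, 'p) coalg_scheme \<Rightarrow> ('k, 'b, 'q) coalg_scheme \<Rightarrow>
    'b \<Rightarrow> ('b, 'h) tensor"
  where "inj_B K H B b = pure K B H b \<one>\<^bsub>H\<^esub>"

definition End_Hopf ::
  "('k, 'm) ring_scheme \<Rightarrow> ('k, 'h, 'p) coalg_scheme \<Rightarrow> ('k, 'b, 'q) coalg_scheme \<Rightarrow>
    ('h \<Rightarrow> 'b \<Rightarrow> 'b) \<Rightarrow> ('b \<Rightarrow> ('h, 'b) tensor) \<Rightarrow> (('b, 'h) tensor \<Rightarrow> ('b, 'h) tensor) set"
  where "End_Hopf K H B act coact =
    (let A = biproduct K H B act coact in
     {F \<in> hopf_maps K A A. \<forall>X \<in> carrier A. proj_H H B (F X) = proj_H H B X})"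

definition left_part ::
  "('k, 'm) ring_scheme \<Rightarrow> ('k, 'h, 'p) coalg_scheme \<Rightarrow> ('k, 'b, 'q) coalg_scheme \<Rightarrow>
    (('b, 'h) tensor \<Rightarrow> ('b, 'h) tensor) \<Rightarrow> 'b \<Rightarrow> 'b"
  where "left_part K H B F = proj_B H B \<circ> F \<circ> inj_B K H B"

definition right_part ::
  "('k, 'm) ring_scheme \<Rightarrow> ('k, 'h, 'p) coalg_scheme \<Rightarrow> ('k, 'b, 'q) coalg_scheme \<Rightarrow>
    (('b, 'h) tensor \<Rightarrow> ('b, 'h) tensor) \<Rightarrow> 'h \<Rightarrow> 'b"
  where "right_part K H B F = proj_B H B \<circ> F \<circ> inj_H K H B"

end

theory Submission
  imports Defs
begin

text \<open>
  Write \<open>X\<^sub>1 \<otimes> X\<^sub>2\<close> for the coproduct of the biproduct \<open>A = B \<times> H\<close>, and \<open>\<pi>\<close>, \<open>j\<close>, \<open>\<Pi>\<close>, \<open>J\<close> for its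
  projections to and injections of \<open>H\<close> and \<open>B\<close>. An element of \<open>A\<close> can be recovered from its
  coproduct: \<open>X = \<Pi>(X\<^sub>1) \<times> \<pi>(X\<^sub>2)\<close> (lemma \<open>reassemble\<close>). For a Hopf endomorphism \<open>F\<close> with
  \<open>\<pi> \<circ> F = \<pi>\<close> this becomes \<open>F(X) = \<Pi>(F(X\<^sub>1)) \<times> \<pi>(X\<^sub>2)\<close>, and on the two factors of the biproduct
  \<^item> \<open>F(J(b)) = J(F\<^sub>L(b))\<close> (lemma \<open>F_inj_B\<close>), since \<open>\<pi>\<close> sees only a counit on \<open>J(B)\<close>;
  \<^item> \<open>F(j(h)) = F\<^sub>R(h\<^sub>1) \<times> h\<^sub>2\<close> (lemma \<open>F_inj_H\<close>).

  All five claims follow from these two formulas. Since \<open>J\<close> is an injective algebra map that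
  preserves the counit, \<open>F\<^sub>L\<close> inherits multiplicativity and compatibility with the counit from \<open>F\<close>. The coproduct and the coaction of
  \<open>B\<close> are \<open>\<Pi> \<otimes> \<Pi>\<close> and \<open>\<pi> \<otimes> \<Pi>\<close> applied to the coproduct of \<open>J(b)\<close>; taking \<open>F\<^sub>L(b)\<close> for \<open>b\<close> and
  moving \<open>F\<close> through the coproduct of \<open>A\<close> gives their values at \<open>F\<^sub>L(b)\<close>, where
  \<open>\<Pi>(F(b \<times> h)) = F\<^sub>L(b) F\<^sub>R(h)\<close> accounts for the factor \<open>F\<^sub>R\<close>. The exchange rule between \<open>F\<^sub>L\<close> and
  \<open>F\<^sub>R\<close> compares two expansions of \<open>\<Pi>(F(j(h) J(b)))\<close>.

  The calculations need the calculus of Sweedler sums behind them: the tensor product is a vector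
  space with its universal property, linear maps commute with Sweedler sums, and such sums are
  linear in each of their parameters.
\<close>

section \<open>The tensor product as a vector space\<close>

context
  fixes K :: "('k, 'm) ring_scheme"
    and V :: "('k, 'v, 'p) module_scheme"
    and W :: "('k, 'w, 'q) module_scheme"
  assumes V: "module K V" and W: "module K W"
begin

interpretation V: module K V by (rule V)
interpretation W: module K W by (rule W)

lemma tensor_eq_subset:
  "tensor_eq K V W x y \<Longrightarrow> set x \<subseteq> carrier V \<times> carrier W \<and> set y \<subseteq> carrier V \<times> carrier W"
  by (induction rule: tensor_eq.induct) auto

lemma tensor_class_eq_iff:
  assumes "set x \<subseteq> carrier V \<times> carrier W"
  shows "tensor_class K V W x = tensor_class K V W y \<longleftrightarrow> tensor_eq K V W x y"
proof
  assume "tensor_class K V W x = tensor_class K V W y"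
  moreover have "x \<in> tensor_class K V W x"
    using assms by (simp add: tensor_class_def tensor_eq.refl)
  ultimately show "tensor_eq K V W x y"
    by (auto simp: tensor_class_def intro: tensor_eq.sym)
qed (auto simp: tensor_class_def intro: tensor_eq.sym tensor_eq.trans)

lemma tensor_class_closed [simp]:
  "set x \<subseteq> carrier V \<times> carrier W \<Longrightarrow> tensor_class K V W x \<in> carrier (tensor K V W)"
  by (auto simp: tensor_def)

lemma tensor_rep_class:
  assumes "set x \<subseteq> carrier V \<times> carrier W"
  shows "tensor_eq K V W x (tensor_rep (tensor_class K V W x))"
proof -
  have "tensor_rep (tensor_class K V W x) \<in> tensor_class K V W x"
    unfolding tensor_rep_def
    by (rule someI[of _ x]) (simp add: tensor_class_def tensor_eq.refl assms)
  then show ?thesis by (simp add: tensor_class_def)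
qed

lemma tensor_rep_subset:
  assumes "X \<in> carrier (tensor K V W)"
  shows "set (tensor_rep X) \<subseteq> carrier V \<times> carrier W"
  using assms tensor_eq_subset[OF tensor_rep_class] by (auto simp: tensor_def)

lemma tensor_cases:
  assumes "X \<in> carrier (tensor K V W)"
  obtains x where "X = tensor_class K V W x" "set x \<subseteq> carrier V \<times> carrier W"
  using assms by (auto simp: tensor_def)

lemma tensor_add_class:
  assumes "set x \<subseteq> carrier V \<times> carrier W" "set y \<subseteq> carrier V \<times> carrier W"
  shows "tensor_class K V W x \<oplus>\<^bsub>tensor K V W\<^esub> tensor_class K V W y = tensor_class K V W (x @ y)"
proof -
  have "tensor_eq K V W (x @ y) (tensor_rep (tensor_class K V W x) @ tensor_rep (tensor_class K V W y))"
    by (intro tensor_eq.append tensor_rep_class assms)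
  then show ?thesis
    using tensor_class_eq_iff[of "x @ y"] assms by (simp add: tensor_def del: set_append) auto
qed

lemma smult_image_subset [simp]:
  "S \<subseteq> carrier V \<times> carrier W \<Longrightarrow> c \<in> carrier K \<Longrightarrow>
    (\<lambda>(v, w). (c \<odot>\<^bsub>V\<^esub> v, w)) ` S \<subseteq> carrier V \<times> carrier W"
  by auto

lemma tensor_eq_smult:
  assumes "tensor_eq K V W x y" "c \<in> carrier K"
  shows "tensor_eq K V W [(c \<odot>\<^bsub>V\<^esub> v, w). (v, w) \<leftarrow> x] [(c \<odot>\<^bsub>V\<^esub> v, w). (v, w) \<leftarrow> y]"
  using assms(1)
proof induction
  case (zero w)
  then show ?case using assms(2) by (auto intro: tensor_eq.zero)
next
  case (add_left v v' w)
  then show ?case using assms(2) by (auto simp: V.smult_r_distr intro: tensor_eq.add_left)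
next
  case (add_right v w w')
  then show ?case using assms(2) by (auto intro: tensor_eq.add_right)
next
  case (smult d v w)
  have "c \<odot>\<^bsub>V\<^esub> (d \<odot>\<^bsub>V\<^esub> v) = d \<odot>\<^bsub>V\<^esub> (c \<odot>\<^bsub>V\<^esub> v)"
    using assms(2) smult by (simp add: V.smult_assoc1[symmetric] V.m_comm)
  then show ?case using assms(2) smult by (auto intro: tensor_eq.smult)
next
  case (refl x) then show ?case using assms(2) by (intro tensor_eq.refl) auto
next
  case (commute x y)
  then show ?case using assms(2) by (simp add: tensor_eq.commute)
qed (auto intro: tensor_eq.sym tensor_eq.trans tensor_eq.append)

lemma tensor_smult_class:
  assumes "set x \<subseteq> carrier V \<times> carrier W" "c \<in> carrier K"
  shows "c \<odot>\<^bsub>tensor K V W\<^esub> tensor_class K V W x = tensor_class K V W [(c \<odot>\<^bsub>V\<^esub> v, w). (v, w) \<leftarrow> x]"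
proof -
  have "tensor_eq K V W [(c \<odot>\<^bsub>V\<^esub> v, w). (v, w) \<leftarrow> x]
    [(c \<odot>\<^bsub>V\<^esub> v, w). (v, w) \<leftarrow> tensor_rep (tensor_class K V W x)]"
    by (intro tensor_eq_smult tensor_rep_class assms)
  then show ?thesis
    using tensor_class_eq_iff tensor_eq_subset by (fastforce simp: tensor_def)
qed

lemma tensor_zero: "\<zero>\<^bsub>tensor K V W\<^esub> = tensor_class K V W []"
  by (simp add: tensor_def)

lemma tensor_class_Cons:
  assumes "v \<in> carrier V" "w \<in> carrier W" "set x \<subseteq> carrier V \<times> carrier W"
  shows "tensor_class K V W ((v, w) # x) = pure K V W v w \<oplus>\<^bsub>tensor K V W\<^esub> tensor_class K V W x"
  using assms by (simp add: pure_def tensor_add_class)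

lemma pure_closed [simp]:
  "v \<in> carrier V \<Longrightarrow> w \<in> carrier W \<Longrightarrow> pure K V W v w \<in> carrier (tensor K V W)"
  by (simp add: pure_def)

lemma pure_add_left:
  "v \<in> carrier V \<Longrightarrow> v' \<in> carrier V \<Longrightarrow> w \<in> carrier W \<Longrightarrow>
    pure K V W (v \<oplus>\<^bsub>V\<^esub> v') w = pure K V W v w \<oplus>\<^bsub>tensor K V W\<^esub> pure K V W v' w"
  by (simp add: pure_def tensor_add_class tensor_class_eq_iff tensor_eq.add_left)

lemma pure_add_right:
  "v \<in> carrier V \<Longrightarrow> w \<in> carrier W \<Longrightarrow> w' \<in> carrier W \<Longrightarrow>
    pure K V W v (w \<oplus>\<^bsub>W\<^esub> w') = pure K V W v w \<oplus>\<^bsub>tensor K V W\<^esub> pure K V W v w'"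
  by (simp add: pure_def tensor_add_class tensor_class_eq_iff tensor_eq.add_right)

lemma pure_smult_left:
  "c \<in> carrier K \<Longrightarrow> v \<in> carrier V \<Longrightarrow> w \<in> carrier W \<Longrightarrow>
    pure K V W (c \<odot>\<^bsub>V\<^esub> v) w = c \<odot>\<^bsub>tensor K V W\<^esub> pure K V W v w"
  by (simp add: pure_def tensor_smult_class)

lemma pure_smult_right:
  "c \<in> carrier K \<Longrightarrow> v \<in> carrier V \<Longrightarrow> w \<in> carrier W \<Longrightarrow>
    pure K V W v (c \<odot>\<^bsub>W\<^esub> w) = c \<odot>\<^bsub>tensor K V W\<^esub> pure K V W v w"
  by (simp add: pure_smult_left[symmetric])
    (simp add: pure_def tensor_class_eq_iff tensor_eq.smult tensor_eq.sym)

lemma pure_zero_left: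
  "w \<in> carrier W \<Longrightarrow> pure K V W \<zero>\<^bsub>V\<^esub> w = \<zero>\<^bsub>tensor K V W\<^esub>"
  by (simp add: pure_def tensor_zero tensor_class_eq_iff tensor_eq.zero)

lemma tensor_abelian_monoid: "abelian_monoid (tensor K V W)"
proof (rule abelian_monoidI)
  fix X Y assume X: "X \<in> carrier (tensor K V W)" and Y: "Y \<in> carrier (tensor K V W)"
  obtain x where x: "X = tensor_class K V W x" "set x \<subseteq> carrier V \<times> carrier W"
    using X by (rule tensor_cases)
  obtain y where y: "Y = tensor_class K V W y" "set y \<subseteq> carrier V \<times> carrier W"
    using Y by (rule tensor_cases)
  show "X \<oplus>\<^bsub>tensor K V W\<^esub> Y \<in> carrier (tensor K V W)"
    using x y by (simp add: tensor_add_class)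
  show "X \<oplus>\<^bsub>tensor K V W\<^esub> Y = Y \<oplus>\<^bsub>tensor K V W\<^esub> X"
    using x y by (simp add: tensor_add_class tensor_class_eq_iff tensor_eq.commute)
  show "\<zero>\<^bsub>tensor K V W\<^esub> \<oplus>\<^bsub>tensor K V W\<^esub> X = X"
    using x by (simp add: tensor_zero tensor_add_class)
  fix Z assume Z: "Z \<in> carrier (tensor K V W)"
  obtain z where z: "Z = tensor_class K V W z" "set z \<subseteq> carrier V \<times> carrier W"
    using Z by (rule tensor_cases)
  show "X \<oplus>\<^bsub>tensor K V W\<^esub> Y \<oplus>\<^bsub>tensor K V W\<^esub> Z =
      X \<oplus>\<^bsub>tensor K V W\<^esub> (Y \<oplus>\<^bsub>tensor K V W\<^esub> Z)"
    using x y z by (simp add: tensor_add_class)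
qed (simp add: tensor_zero)

interpretation T: abelian_monoid "tensor K V W" by (rule tensor_abelian_monoid)

text \<open>
  Distributivity of scalars permutes the entries of a representing list. Therefore the remaining
  vector space axioms are checked on pure tensors and extended to their sums.
\<close>

lemma tensor_induct [consumes 1, case_names zero add]:
  assumes "X \<in> carrier (tensor K V W)"
    and "P \<zero>\<^bsub>tensor K V W\<^esub>"
    and "\<And>v w X. \<lbrakk>v \<in> carrier V; w \<in> carrier W; X \<in> carrier (tensor K V W); P X\<rbrakk> \<Longrightarrow>
      P (pure K V W v w \<oplus>\<^bsub>tensor K V W\<^esub> X)"
  shows "P X"
proof -
  obtain x where x: "X = tensor_class K V W x" "set x \<subseteq> carrier V \<times> carrier W"
    using assms(1) by (rule tensor_cases)
  from x(2) have "P (tensor_class K V W x)"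
  proof (induction x)
    case Nil
    then show ?case using assms(2) by (simp add: tensor_zero)
  next
    case (Cons a x)
    then show ?case by (cases a) (auto simp: tensor_class_Cons intro!: assms(3))
  qed
  with x show ?thesis by simp
qed

lemma tensor_smult_closed:
  "c \<in> carrier K \<Longrightarrow> X \<in> carrier (tensor K V W) \<Longrightarrow> c \<odot>\<^bsub>tensor K V W\<^esub> X \<in> carrier (tensor K V W)"
  by (erule tensor_cases) (simp add: tensor_smult_class)

lemma tensor_smult_add:
  assumes "c \<in> carrier K" "X \<in> carrier (tensor K V W)" "Y \<in> carrier (tensor K V W)"
  shows "c \<odot>\<^bsub>tensor K V W\<^esub> (X \<oplus>\<^bsub>tensor K V W\<^esub> Y) =
    c \<odot>\<^bsub>tensor K V W\<^esub> X \<oplus>\<^bsub>tensor K V W\<^esub> c \<odot>\<^bsub>tensor K V W\<^esub> Y"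
proof -
  obtain x where x: "X = tensor_class K V W x" "set x \<subseteq> carrier V \<times> carrier W"
    using assms(2) by (rule tensor_cases)
  obtain y where y: "Y = tensor_class K V W y" "set y \<subseteq> carrier V \<times> carrier W"
    using assms(3) by (rule tensor_cases)
  show ?thesis
    using x y assms(1) by (simp add: tensor_add_class tensor_smult_class)
qed

lemma tensor_smult_zero:
  "c \<in> carrier K \<Longrightarrow> c \<odot>\<^bsub>tensor K V W\<^esub> \<zero>\<^bsub>tensor K V W\<^esub> = \<zero>\<^bsub>tensor K V W\<^esub>"
  by (simp add: tensor_zero tensor_smult_class)

lemma tensor_add_smult:
  assumes "c \<in> carrier K" "d \<in> carrier K" "X \<in> carrier (tensor K V W)"
  shows "(c \<oplus>\<^bsub>K\<^esub> d) \<odot>\<^bsub>tensor K V W\<^esub> X = c \<odot>\<^bsub>tensor K V W\<^esub> X \<oplus>\<^bsub>tensor K V W\<^esub> d \<odot>\<^bsub>tensor K V W\<^esub> X"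
  using assms(3)
proof (induction rule: tensor_induct)
  case zero
  then show ?case using assms by (simp add: tensor_smult_zero)
next
  case (add v w X)
  have "(c \<oplus>\<^bsub>K\<^esub> d) \<odot>\<^bsub>tensor K V W\<^esub> pure K V W v w
      = c \<odot>\<^bsub>tensor K V W\<^esub> pure K V W v w \<oplus>\<^bsub>tensor K V W\<^esub> d \<odot>\<^bsub>tensor K V W\<^esub> pure K V W v w"
    using add assms by (simp add: pure_smult_left[symmetric] V.smult_l_distr pure_add_left)
  then show ?case
    using add assms by (simp add: tensor_smult_add tensor_smult_closed T.a_ac)
qed

lemma module_tensor [simp]: "module K (tensor K V W)"
proof (rule moduleI)
  show "cring K" by (rule V.is_cring)
  have one: "\<one>\<^bsub>K\<^esub> \<odot>\<^bsub>tensor K V W\<^esub> X = X" if "X \<in> carrier (tensor K V W)" for X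
    using that
    by (induction rule: tensor_induct)
      (simp_all add: tensor_smult_zero tensor_smult_add pure_smult_left[symmetric])
  have null: "\<zero>\<^bsub>K\<^esub> \<odot>\<^bsub>tensor K V W\<^esub> X = \<zero>\<^bsub>tensor K V W\<^esub>" if "X \<in> carrier (tensor K V W)" for X
    using that
    by (induction rule: tensor_induct)
      (simp_all add: tensor_smult_zero tensor_smult_add pure_smult_left[symmetric] pure_zero_left)
  show "abelian_group (tensor K V W)"
  proof (rule abelian_groupI)
    fix X assume X: "X \<in> carrier (tensor K V W)"
    \<comment> \<open>additive inverses come from the scalar \<open>-1\<close>\<close>
    have "(\<ominus>\<^bsub>K\<^esub> \<one>\<^bsub>K\<^esub>) \<odot>\<^bsub>tensor K V W\<^esub> X \<oplus>\<^bsub>tensor K V W\<^esub> X =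
        (\<ominus>\<^bsub>K\<^esub> \<one>\<^bsub>K\<^esub> \<oplus>\<^bsub>K\<^esub> \<one>\<^bsub>K\<^esub>) \<odot>\<^bsub>tensor K V W\<^esub> X"
      using X by (simp add: tensor_add_smult one)
    also have "\<dots> = \<zero>\<^bsub>tensor K V W\<^esub>" using X by (simp add: V.R.l_neg null)
    finally show "\<exists>Y\<in>carrier (tensor K V W). Y \<oplus>\<^bsub>tensor K V W\<^esub> X = \<zero>\<^bsub>tensor K V W\<^esub>"
      using X tensor_smult_closed V.R.a_inv_closed V.R.one_closed by blast
  qed (simp_all add: T.a_ac)
  show "(c \<otimes>\<^bsub>K\<^esub> d) \<odot>\<^bsub>tensor K V W\<^esub> X = c \<odot>\<^bsub>tensor K V W\<^esub> (d \<odot>\<^bsub>tensor K V W\<^esub> X)"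
    if "c \<in> carrier K" "d \<in> carrier K" "X \<in> carrier (tensor K V W)" for c d X
    using that(3)
    by (induction rule: tensor_induct)
      (simp_all add: that(1,2) tensor_smult_zero tensor_smult_add tensor_smult_closed
        pure_smult_left[symmetric] V.smult_assoc1)
  show "\<one>\<^bsub>K\<^esub> \<odot>\<^bsub>tensor K V W\<^esub> X = X" if "X \<in> carrier (tensor K V W)" for X
    using that by (rule one)
qed (simp_all add: tensor_smult_closed tensor_add_smult tensor_smult_add)

end

section \<open>Linear and bilinear maps\<close>

lemma module_base: "field K \<Longrightarrow> module K (base K)"
proof -
  assume "field K"
  then interpret K: field K .
  show ?thesis
  proof (rule moduleI)
    show "abelian_group (base K)"
      by (rule abelian_groupI) (auto simp: base_def K.a_ac intro: K.l_neg bexI[of _ "\<ominus>\<^bsub>K\<^esub> x" for x])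
  qed (auto simp: base_def K.l_distr K.r_distr K.m_assoc K.is_cring)
qed

lemma linear_mapsI:
  assumes "\<And>x. x \<in> carrier V \<Longrightarrow> f x \<in> carrier W"
    and "\<And>x y. x \<in> carrier V \<Longrightarrow> y \<in> carrier V \<Longrightarrow> f (x \<oplus>\<^bsub>V\<^esub> y) = f x \<oplus>\<^bsub>W\<^esub> f y"
    and "\<And>c x. c \<in> carrier K \<Longrightarrow> x \<in> carrier V \<Longrightarrow> f (c \<odot>\<^bsub>V\<^esub> x) = c \<odot>\<^bsub>W\<^esub> f x"
  shows "f \<in> linear_maps K V W"
  using assms by (auto simp: linear_maps_def)

lemma linear_maps_closed: "f \<in> linear_maps K V W \<Longrightarrow> x \<in> carrier V \<Longrightarrow> f x \<in> carrier W"
  and linear_maps_add: "f \<in> linear_maps K V W \<Longrightarrow> x \<in> carrier V \<Longrightarrow> y \<in> carrier V \<Longrightarrow>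
    f (x \<oplus>\<^bsub>V\<^esub> y) = f x \<oplus>\<^bsub>W\<^esub> f y"
  and linear_maps_smult: "f \<in> linear_maps K V W \<Longrightarrow> c \<in> carrier K \<Longrightarrow> x \<in> carrier V \<Longrightarrow>
    f (c \<odot>\<^bsub>V\<^esub> x) = c \<odot>\<^bsub>W\<^esub> f x"
  by (auto simp: linear_maps_def)

lemma linear_maps_zero:
  assumes "module K V" "module K W" "f \<in> linear_maps K V W"
  shows "f \<zero>\<^bsub>V\<^esub> = \<zero>\<^bsub>W\<^esub>"
proof -
  interpret V: module K V by fact
  interpret W: module K W by fact
  have "f (\<zero>\<^bsub>K\<^esub> \<odot>\<^bsub>V\<^esub> \<zero>\<^bsub>V\<^esub>) = \<zero>\<^bsub>K\<^esub> \<odot>\<^bsub>W\<^esub> f \<zero>\<^bsub>V\<^esub>"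
    using assms(3) by (intro linear_maps_smult) auto
  then show ?thesis using linear_maps_closed[OF assms(3)] by simp
qed

lemma linear_id: "(\<lambda>x. x) \<in> linear_maps K V V"
  by (auto simp: linear_maps_def)

lemma linear_comp:
  "g \<in> linear_maps K V W \<Longrightarrow> f \<in> linear_maps K U V \<Longrightarrow> (\<lambda>x. g (f x)) \<in> linear_maps K U W"
  by (auto simp: linear_maps_def Pi_iff)

lemma bilinear_mapsI:
  assumes "\<And>v. v \<in> carrier V \<Longrightarrow> \<beta> v \<in> linear_maps K W U"
    and "\<And>w. w \<in> carrier W \<Longrightarrow> (\<lambda>v. \<beta> v w) \<in> linear_maps K V U"
  shows "\<beta> \<in> bilinear_maps K V W U"
  using assms by (auto simp: bilinear_maps_def)

lemma bilinear_closed: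
  "\<beta> \<in> bilinear_maps K V W U \<Longrightarrow> v \<in> carrier V \<Longrightarrow> w \<in> carrier W \<Longrightarrow> \<beta> v w \<in> carrier U"
  by (auto simp: bilinear_maps_def linear_maps_def)

lemma bilinear_left:
  "\<beta> \<in> bilinear_maps K V W U \<Longrightarrow> f \<in> linear_maps K P V \<Longrightarrow> w \<in> carrier W \<Longrightarrow>
    (\<lambda>x. \<beta> (f x) w) \<in> linear_maps K P U"
  by (rule linear_comp[of "\<lambda>v. \<beta> v w" K V U f P]) (auto simp: bilinear_maps_def)

lemma bilinear_right:
  "\<beta> \<in> bilinear_maps K V W U \<Longrightarrow> f \<in> linear_maps K P W \<Longrightarrow> v \<in> carrier V \<Longrightarrow>
    (\<lambda>x. \<beta> v (f x)) \<in> linear_maps K P U"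
  by (rule linear_comp[of "\<beta> v" K W U f P]) (auto simp: bilinear_maps_def)

lemma pure_bilinear:
  assumes "module K V" "module K W"
  shows "pure K V W \<in> bilinear_maps K V W (tensor K V W)"
  using assms
  by (auto intro!: bilinear_mapsI linear_mapsI
    simp: pure_add_left pure_add_right pure_smult_left pure_smult_right)

lemma smult_bilinear:
  assumes "module K V"
  shows "smult V \<in> bilinear_maps K (base K) V V"
proof -
  interpret V: module K V by fact
  show ?thesis
    by (auto intro!: bilinear_mapsI linear_mapsI
      simp: base_def V.smult_l_distr V.smult_r_distr V.smult_assoc1[symmetric] V.m_comm)
qed

lemma mult_bilinear:
  assumes "k_algebra K A"
  shows "mult A \<in> bilinear_maps K A A A"
proof -
  interpret A: k_algebra K A by fact
  have "ring A" using assms by (simp add: k_algebra_def)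
  note distrib = ringE(3,4)[OF this]
  show ?thesis
    by (auto intro!: bilinear_mapsI linear_mapsI
      simp: distrib A.smult_mult_left A.smult_mult_right)
qed

section \<open>The linear map induced by a bilinear map\<close>

abbreviation pair_sum ::
  "('k, 'u, 'r) module_scheme \<Rightarrow> ('v \<Rightarrow> 'w \<Rightarrow> 'u) \<Rightarrow> ('v \<times> 'w) list \<Rightarrow> 'u"
  where "pair_sum U \<beta> x \<equiv> foldr (\<lambda>(v, w) s. \<beta> v w \<oplus>\<^bsub>U\<^esub> s) x \<zero>\<^bsub>U\<^esub>"

lemma pair_sum_closed:
  assumes "abelian_monoid U" "\<And>v w. (v, w) \<in> set x \<Longrightarrow> \<beta> v w \<in> carrier U"
  shows "pair_sum U \<beta> x \<in> carrier U"
proof -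
  interpret U: abelian_monoid U by fact
  show ?thesis using assms(2) by (induction x) auto
qed

lemma pair_sum_append:
  assumes "abelian_monoid U"
    and "\<And>v w. (v, w) \<in> set x \<Longrightarrow> \<beta> v w \<in> carrier U"
    and "\<And>v w. (v, w) \<in> set y \<Longrightarrow> \<beta> v w \<in> carrier U"
  shows "pair_sum U \<beta> (x @ y) = pair_sum U \<beta> x \<oplus>\<^bsub>U\<^esub> pair_sum U \<beta> y"
proof -
  interpret U: abelian_monoid U by fact
  have y: "pair_sum U \<beta> y \<in> carrier U" using assms by (intro pair_sum_closed)
  show ?thesis using assms(2)
  proof (induction x)
    case (Cons a x)
    have "pair_sum U \<beta> x \<in> carrier U"
      using Cons.prems by (intro pair_sum_closed assms(1)) auto
    then show ?case using Cons y by (cases a) (auto simp: U.a_assoc)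
  qed (use y in simp)
qed

lemma module_abelian_monoid: "module K U \<Longrightarrow> abelian_monoid U"
  by (simp add: module_def abelian_group_def)

context
  fixes K :: "('k, 'm) ring_scheme"
    and V :: "('k, 'v, 'p) module_scheme"
    and W :: "('k, 'w, 'q) module_scheme"
    and U :: "('k, 'u, 'r) module_scheme"
  assumes V: "module K V" and W: "module K W" and U: "module K U"
begin

interpretation V: module K V by (rule V)
interpretation W: module K W by (rule W)
interpretation U: module K U by (rule U)

text \<open>
  The universal property of the tensor product: bilinearity is exactly compatibility with the
  relations that generate the congruence, so the value does not depend on the representing list.
\<close>

lemma pair_sum_tensor_eq:
  assumes "tensor_eq K V W x y" and \<beta>: "\<beta> \<in> bilinear_maps K V W U"
  shows "pair_sum U \<beta> x = pair_sum U \<beta> y"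
  using assms(1)
proof induction
  note closed = bilinear_closed[OF \<beta>]
  have left: "(\<lambda>v. \<beta> v w) \<in> linear_maps K V U" if "w \<in> carrier W" for w
    using \<beta> that by (auto simp: bilinear_maps_def)
  have right: "\<beta> v \<in> linear_maps K W U" if "v \<in> carrier V" for v
    using \<beta> that by (auto simp: bilinear_maps_def)
  have sum_append: "pair_sum U \<beta> (x @ y) = pair_sum U \<beta> x \<oplus>\<^bsub>U\<^esub> pair_sum U \<beta> y"
    if "set x \<subseteq> carrier V \<times> carrier W" "set y \<subseteq> carrier V \<times> carrier W" for x y
    using that closed by (intro pair_sum_append module_abelian_monoid[OF U]) blast+
  have sum_closed: "pair_sum U \<beta> x \<in> carrier U" if "set x \<subseteq> carrier V \<times> carrier W" for x
    using that closed by (intro pair_sum_closed module_abelian_monoid[OF U]) blast+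
  {
    case (append x x' y y')
    then show ?case using tensor_eq_subset[OF V W] by (metis sum_append)
  next
    case (commute x y)
    then show ?case by (simp only: sum_append) (intro U.a_comm sum_closed)
  next
    case (zero w)
    then show ?case using linear_maps_zero[OF V U left] by simp
  next
    case (add_left v v' w)
    then show ?case using linear_maps_add[OF left] closed by (simp add: U.a_assoc)
  next
    case (add_right v w w')
    then show ?case using linear_maps_add[OF right] closed by (simp add: U.a_assoc)
  next
    case (smult c v w)
    then show ?case using linear_maps_smult[OF left] linear_maps_smult[OF right] by simp
  }
qed simp_all

lemma tsum_class:
  assumes "set x \<subseteq> carrier V \<times> carrier W" "\<beta> \<in> bilinear_maps K V W U"
  shows "tsum U (tensor_class K V W x) \<beta> = pair_sum U \<beta> x"
  unfolding tsum_def
  using pair_sum_tensor_eq[OF tensor_rep_class[OF V W assms(1)] assms(2)] by simp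

lemma tsum_pure:
  assumes "\<beta> \<in> bilinear_maps K V W U" "v \<in> carrier V" "w \<in> carrier W"
  shows "tsum U (pure K V W v w) \<beta> = \<beta> v w"
  using assms by (simp add: pure_def tsum_class bilinear_closed)

lemma tsum_closed:
  assumes "X \<in> carrier (tensor K V W)"
    and "\<And>v w. v \<in> carrier V \<Longrightarrow> w \<in> carrier W \<Longrightarrow> \<beta> v w \<in> carrier U"
  shows "tsum U X \<beta> \<in> carrier U"
  unfolding tsum_def
  using tensor_rep_subset[OF V W assms(1)] assms(2)
  by (intro pair_sum_closed module_abelian_monoid[OF U]) blast+

lemma tsum_cong:
  assumes "X \<in> carrier (tensor K V W)"
    and "\<And>v w. v \<in> carrier V \<Longrightarrow> w \<in> carrier W \<Longrightarrow> \<beta> v w = \<beta>' v w"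
  shows "tsum U X \<beta> = tsum U X \<beta>'"
  unfolding tsum_def
  using tensor_rep_subset[OF V W assms(1)] assms(2) by (intro foldr_cong) auto

text \<open>
  The argument of \<^const>\<open>tsum\<close> can be replaced by any convenient representing list, on which
  addition is concatenation.
\<close>

lemma tsum_linear:
  assumes \<beta>: "\<beta> \<in> bilinear_maps K V W U"
  shows "(\<lambda>X. tsum U X \<beta>) \<in> linear_maps K (tensor K V W) U"
proof (rule linear_mapsI)
  note closed = bilinear_closed[OF \<beta>]
  fix X assume X: "X \<in> carrier (tensor K V W)"
  then show "tsum U X \<beta> \<in> carrier U"
    using closed by (intro tsum_closed)
  obtain x where x: "X = tensor_class K V W x" "set x \<subseteq> carrier V \<times> carrier W"
    using X by (rule tensor_cases[OF V W])
  {
    fix Y assume Y: "Y \<in> carrier (tensor K V W)"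
    obtain y where y: "Y = tensor_class K V W y" "set y \<subseteq> carrier V \<times> carrier W"
      using Y by (rule tensor_cases[OF V W])
    have "tsum U (X \<oplus>\<^bsub>tensor K V W\<^esub> Y) \<beta> = pair_sum U \<beta> (x @ y)"
      using x y \<beta> by (simp add: tensor_add_class[OF V W] tsum_class del: foldr_append)
    also have "\<dots> = pair_sum U \<beta> x \<oplus>\<^bsub>U\<^esub> pair_sum U \<beta> y"
      using x y closed by (intro pair_sum_append module_abelian_monoid[OF U]) blast+
    finally show "tsum U (X \<oplus>\<^bsub>tensor K V W\<^esub> Y) \<beta> = tsum U X \<beta> \<oplus>\<^bsub>U\<^esub> tsum U Y \<beta>"
      using x y \<beta> by (simp add: tsum_class)
  }
  fix c assume c: "c \<in> carrier K"
  have "pair_sum U \<beta> (map (\<lambda>(v, w). (c \<odot>\<^bsub>V\<^esub> v, w)) x) = c \<odot>\<^bsub>U\<^esub> pair_sum U \<beta> x"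
    using x(2)
  proof (induction x)
    case Nil
    then show ?case using c by simp
  next
    case (Cons a x)
    obtain v w where a: "a = (v, w)" "v \<in> carrier V" "w \<in> carrier W"
      using Cons.prems by auto
    have "\<beta> (c \<odot>\<^bsub>V\<^esub> v) w = c \<odot>\<^bsub>U\<^esub> \<beta> v w"
      using \<beta> a c by (auto simp: bilinear_maps_def linear_maps_def)
    moreover have "pair_sum U \<beta> x \<in> carrier U"
      using Cons.prems closed by (intro pair_sum_closed module_abelian_monoid[OF U]) auto
    ultimately show ?case
      using Cons a c closed by (simp add: U.smult_r_distr)
  qed
  then show "tsum U (c \<odot>\<^bsub>tensor K V W\<^esub> X) \<beta> = c \<odot>\<^bsub>U\<^esub> tsum U X \<beta>"
    using x \<beta> c smult_image_subset[OF V W]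
    by (simp add: tensor_smult_class[OF V W] tsum_class del: foldr_map)
qed

lemma tensor_linear_ext:
  assumes f: "f \<in> linear_maps K (tensor K V W) U" and g: "g \<in> linear_maps K (tensor K V W) U"
    and eq: "\<And>v w. v \<in> carrier V \<Longrightarrow> w \<in> carrier W \<Longrightarrow> f (pure K V W v w) = g (pure K V W v w)"
    and "X \<in> carrier (tensor K V W)"
  shows "f X = g X"
  using assms(4)
proof (induction rule: tensor_induct[OF V W, consumes 1, case_names zero add])
  case zero
  then show ?case
    using linear_maps_zero[OF _ U f] linear_maps_zero[OF _ U g] V W by simp
next
  case (add v w X)
  then show ?case
    using V W eq linear_maps_add[OF f] linear_maps_add[OF g] by simp
qed

text \<open>
  A Sweedler sum may depend linearly on a parameter through the tensor that is summed over or
  through the summand. These two rules together with composition prove the (bi)linearity of every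
  nested Sweedler expression by recursion on its syntax.
\<close>

lemma linear_tsum_argument:
  assumes "f \<in> linear_maps K P (tensor K V W)" "\<beta> \<in> bilinear_maps K V W U"
  shows "(\<lambda>x. tsum U (f x) \<beta>) \<in> linear_maps K P U"
  using tsum_linear[OF assms(2)] assms(1) by (rule linear_comp)

lemma linear_tsum_summand:
  assumes P: "module K P" and X: "X \<in> carrier (tensor K V W)"
    and "\<And>v w. v \<in> carrier V \<Longrightarrow> w \<in> carrier W \<Longrightarrow> (\<lambda>x. \<beta> x v w) \<in> linear_maps K P U"
  shows "(\<lambda>x. tsum U X (\<beta> x)) \<in> linear_maps K P U"
proof -
  interpret P: module K P by (rule P)
  have lin: "(\<lambda>x. \<beta> x v w) \<in> linear_maps K P U" if "(v, w) \<in> set (tensor_rep X)" for v w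
    using that tensor_rep_subset[OF V W X] assms(3) by auto
  have "(\<lambda>p. pair_sum U (\<beta> p) x) \<in> linear_maps K P U" if "set x \<subseteq> set (tensor_rep X)" for x
    using that
  proof (induction x)
    case Nil
    then show ?case by (auto intro: linear_mapsI)
  next
    case (Cons a x)
    obtain v w where a: "a = (v, w)" by (cases a)
    have *: "(\<lambda>p. \<beta> p v w) \<in> linear_maps K P U" using Cons.prems a by (intro lin) simp
    have **: "(\<lambda>p. pair_sum U (\<beta> p) x) \<in> linear_maps K P U" using Cons by simp
    have "(\<lambda>p. \<beta> p v w \<oplus>\<^bsub>U\<^esub> pair_sum U (\<beta> p) x) \<in> linear_maps K P U"
      using linear_maps_closed[OF *] linear_maps_closed[OF **] linear_maps_add[OF *]
        linear_maps_add[OF **] linear_maps_smult[OF *] linear_maps_smult[OF **]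
      by (intro linear_mapsI) (simp_all add: U.a_ac U.smult_r_distr)
    then show ?case by (simp add: a)
  qed
  then show ?thesis unfolding tsum_def by simp
qed

end

text \<open>
  A linear map may be pulled through a Sweedler sum with any summand: a sum over a fixed
  representing list is a finite sum, whether or not the summand is bilinear.
\<close>

lemma tsum_map_linear:
  assumes "module K V" "module K W" and U: "module K U" "module K U'"
    and f: "f \<in> linear_maps K U U'" and X: "X \<in> carrier (tensor K V W)"
    and "\<And>v w. v \<in> carrier V \<Longrightarrow> w \<in> carrier W \<Longrightarrow> \<beta> v w \<in> carrier U"
  shows "f (tsum U X \<beta>) = tsum U' X (\<lambda>v w. f (\<beta> v w))"
proof -
  have "f (pair_sum U \<beta> x) = pair_sum U' (\<lambda>v w. f (\<beta> v w)) x"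
    if "set x \<subseteq> carrier V \<times> carrier W" for x
    using that
  proof (induction x)
    case Nil
    then show ?case using linear_maps_zero[OF U f] by simp
  next
    case (Cons a x)
    obtain v w where a: "a = (v, w)" "v \<in> carrier V" "w \<in> carrier W"
      using Cons.prems by auto
    have "pair_sum U \<beta> x \<in> carrier U"
      using Cons.prems assms(7) by (intro pair_sum_closed module_abelian_monoid[OF U(1)]) auto
    then show ?case using Cons a assms(7) linear_maps_add[OF f] by simp
  qed
  then show ?thesis
    unfolding tsum_def using tensor_rep_subset[OF assms(1,2) X] by blast
qed

lemma tsum_pure_id:
  assumes "module K V" "module K W" "X \<in> carrier (tensor K V W)"
  shows "tsum (tensor K V W) X (pure K V W) = X"
  by (rule tensor_linear_ext[of K V W "tensor K V W"])
    (use assms in \<open>auto intro: tsum_linear pure_bilinear linear_id simp: tsum_pure pure_bilinear\<close>)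

lemma tsum_tsum:
  assumes "module K V" "module K W" "module K P" "module K Q" "module K U"
    and "\<gamma> \<in> bilinear_maps K P Q U" "X \<in> carrier (tensor K V W)"
    and "\<And>v w. v \<in> carrier V \<Longrightarrow> w \<in> carrier W \<Longrightarrow> \<beta> v w \<in> carrier (tensor K P Q)"
  shows "tsum U (tsum (tensor K P Q) X \<beta>) \<gamma> = tsum U X (\<lambda>v w. tsum U (\<beta> v w) \<gamma>)"
  using tsum_linear[OF assms(3,4,5,6)] assms
  by (intro tsum_map_linear[where f = "\<lambda>Z. tsum U Z \<gamma>" and U = "tensor K P Q" and \<beta> = \<beta>])
    simp_all

section \<open>The counit axioms under a linear map\<close>

text \<open>
  A Sweedler sum is contracted below by writing its summand as a counit times a linear function of
  the other component. The following lemmas, and their analogues for the coaction, then evaluate it.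
\<close>

lemma coalgebra_counit_left_linear:
  assumes "k_coalgebra K C" "module K U" "f \<in> linear_maps K C U" "c \<in> carrier C"
  shows "tsum U (comult C c) (\<lambda>c1 c2. counit C c1 \<odot>\<^bsub>U\<^esub> f c2) = f c"
proof -
  interpret C: k_coalgebra K C by fact
  have C: "module K C" by (rule C.module_axioms)
  have counit: "counit C x \<in> carrier K" if "x \<in> carrier C" for x
    using linear_maps_closed[OF C.counit_linear that] by (simp add: base_def)
  have comult: "comult C c \<in> carrier (tensor K C C)"
    by (rule linear_maps_closed[OF C.comult_linear assms(4)])
  have "f (tsum C (comult C c) (\<lambda>c1 c2. counit C c1 \<odot>\<^bsub>C\<^esub> c2)) =
      tsum U (comult C c) (\<lambda>c1 c2. f (counit C c1 \<odot>\<^bsub>C\<^esub> c2))"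
    by (rule tsum_map_linear[OF C C C assms(2,3) comult]) (simp add: counit)
  also have "\<dots> = tsum U (comult C c) (\<lambda>c1 c2. counit C c1 \<odot>\<^bsub>U\<^esub> f c2)"
    by (rule tsum_cong[OF C C assms(2) comult]) (simp add: linear_maps_smult[OF assms(3)] counit)
  finally show ?thesis using C.counit_left[OF assms(4)] by simp
qed

lemma coalgebra_counit_right_linear:
  assumes "k_coalgebra K C" "module K U" "f \<in> linear_maps K C U" "c \<in> carrier C"
  shows "tsum U (comult C c) (\<lambda>c1 c2. counit C c2 \<odot>\<^bsub>U\<^esub> f c1) = f c"
proof -
  interpret C: k_coalgebra K C by fact
  have C: "module K C" by (rule C.module_axioms)
  have counit: "counit C x \<in> carrier K" if "x \<in> carrier C" for x
    using linear_maps_closed[OF C.counit_linear that] by (simp add: base_def)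
  have comult: "comult C c \<in> carrier (tensor K C C)"
    by (rule linear_maps_closed[OF C.comult_linear assms(4)])
  have "f (tsum C (comult C c) (\<lambda>c1 c2. counit C c2 \<odot>\<^bsub>C\<^esub> c1)) =
      tsum U (comult C c) (\<lambda>c1 c2. f (counit C c2 \<odot>\<^bsub>C\<^esub> c1))"
    by (rule tsum_map_linear[OF C C C assms(2,3) comult]) (simp add: counit)
  also have "\<dots> = tsum U (comult C c) (\<lambda>c1 c2. counit C c2 \<odot>\<^bsub>U\<^esub> f c1)"
    by (rule tsum_cong[OF C C assms(2) comult]) (simp add: linear_maps_smult[OF assms(3)] counit)
  finally show ?thesis using C.counit_right[OF assms(4)] by simp
qed

section \<open>Linearity of the structure maps\<close>

context biproduct_data
begin

abbreviation "T \<equiv> tensor K B H"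
abbreviation "TT \<equiv> tensor K T T"
abbreviation "A \<equiv> biproduct K H B act coact"

lemma modules [simp]: "module K H" "module K B" "module K (base K)"
  using module_axioms M.module_axioms module_base field_axioms by auto

lemma base_simps [simp]: "carrier (base K) = carrier K" "mult (base K) = mult K" "\<one>\<^bsub>base K\<^esub> = \<one>\<^bsub>K\<^esub>"
  by (simp_all add: base_def)

lemma algebras: "k_algebra K H" "k_algebra K B"
  using k_algebra_axioms B.k_algebra_axioms by auto

lemma base_mult_bilinear: "mult K \<in> bilinear_maps K (base K) (base K) (base K)"
proof -
  have "ring K" using field_axioms by (simp add: field_def domain_def cring_def)
  note distrib = ringE(3,4)[OF this]
  show ?thesis
    by (intro bilinear_mapsI linear_mapsI) (auto simp: base_def distrib m_ac)
qed

lemma ring_B: "ring B" and ring_H: "ring H"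
  using algebras by (auto simp: k_algebra_def)

lemmas H_mult_closed [simp] = monoid.m_closed[OF ringE(2)[OF ring_H]]
  and B_mult_closed [simp] = monoid.m_closed[OF ringE(2)[OF ring_B]]
  and H_one_closed [simp] = monoid.one_closed[OF ringE(2)[OF ring_H]]
  and B_one_closed [simp] = monoid.one_closed[OF ringE(2)[OF ring_B]]
  and H_l_one [simp] = monoid.l_one[OF ringE(2)[OF ring_H]]
  and B_l_one [simp] = monoid.l_one[OF ringE(2)[OF ring_B]]
  and H_r_one [simp] = monoid.r_one[OF ringE(2)[OF ring_H]]
  and B_r_one [simp] = monoid.r_one[OF ringE(2)[OF ring_B]]

lemmas act_closed [simp] = bilinear_closed[OF act_bilinear]
  and coact_closed [simp] = linear_maps_closed[OF coact_linear]
  and comult_H_closed [simp] = linear_maps_closed[OF comult_linear]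
  and comult_B_closed [simp] = linear_maps_closed[OF B.comult_linear]
  and counit_H_closed [simp] = linear_maps_closed[OF counit_linear, simplified]
  and counit_B_closed [simp] = linear_maps_closed[OF B.counit_linear, simplified]

lemma comult_H_one: "comult H \<one>\<^bsub>H\<^esub> = pure K H H \<one>\<^bsub>H\<^esub> \<one>\<^bsub>H\<^esub>"
  using comult_algebra_map by (simp add: algebra_maps_def ring_hom_def tensor_def pure_def)

lemma coact_one: "coact \<one>\<^bsub>B\<^esub> = pure K H B \<one>\<^bsub>H\<^esub> \<one>\<^bsub>B\<^esub>"
  using coact_algebra_map by (simp add: algebra_maps_def ring_hom_def tensor_def pure_def)

lemma counit_H_one [simp]: "counit H \<one>\<^bsub>H\<^esub> = \<one>\<^bsub>K\<^esub>"
  using counit_algebra_map by (simp add: algebra_maps_def ring_hom_def)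

lemma counit_B_one [simp]: "counit B \<one>\<^bsub>B\<^esub> = \<one>\<^bsub>K\<^esub>"
  using counit_B_algebra_map by (simp add: algebra_maps_def ring_hom_def)

lemma counit_H_mult [simp]: "g \<in> carrier H \<Longrightarrow> h \<in> carrier H \<Longrightarrow>
    counit H (g \<otimes>\<^bsub>H\<^esub> h) = counit H g \<otimes>\<^bsub>K\<^esub> counit H h"
  using counit_algebra_map by (simp add: algebra_maps_def ring_hom_def)

text \<open>
  Backward rules that reduce linearity of a nested expression to closure conditions. The rotations
  put the premise that determines the tensor factors before those that only mention them.
\<close>

lemmas linear_rules =
  linear_id
  bilinear_left[OF pure_bilinear] bilinear_right[OF pure_bilinear]
  bilinear_left[OF act_bilinear] bilinear_right[OF act_bilinear]
  bilinear_left[OF mult_bilinear[OF algebras(1)]] bilinear_right[OF mult_bilinear[OF algebras(1)]]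
  bilinear_left[OF mult_bilinear[OF algebras(2)]] bilinear_right[OF mult_bilinear[OF algebras(2)]]
  bilinear_left[OF base_mult_bilinear] bilinear_right[OF base_mult_bilinear]
  bilinear_left[OF smult_bilinear] bilinear_right[OF smult_bilinear]
  linear_comp[OF comult_linear] linear_comp[OF B.comult_linear]
  linear_comp[OF counit_linear] linear_comp[OF B.counit_linear]
  linear_comp[OF coact_linear]
  linear_tsum_argument[rotated 3] linear_tsum_summand[rotated 4]
  linear_maps_closed[OF comult_linear] linear_maps_closed[OF B.comult_linear]
  linear_maps_closed[OF coact_linear]
  bilinear_mapsI

section \<open>Projections and injections\<close>

lemma proj_B_bilinear: "(\<lambda>b h. counit H h \<odot>\<^bsub>B\<^esub> b) \<in> bilinear_maps K B H B"
  by (rule linear_rules | simp)+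

lemma proj_H_bilinear: "(\<lambda>b h. counit B b \<odot>\<^bsub>H\<^esub> h) \<in> bilinear_maps K B H H"
  by (rule linear_rules | simp)+

lemma proj_B_linear: "proj_B H B \<in> linear_maps K T B"
  unfolding proj_B_def by (intro tsum_linear proj_B_bilinear) simp_all

lemma proj_H_linear: "proj_H H B \<in> linear_maps K T H"
  unfolding proj_H_def by (intro tsum_linear proj_H_bilinear) simp_all

lemma inj_B_linear: "inj_B K H B \<in> linear_maps K B T"
  unfolding inj_B_def by (rule linear_rules | simp)+

lemma inj_H_linear: "inj_H K H B \<in> linear_maps K H T"
  unfolding inj_H_def by (rule linear_rules | simp)+

lemmas proj_B_closed [simp] = linear_maps_closed[OF proj_B_linear]
  and proj_H_closed [simp] = linear_maps_closed[OF proj_H_linear]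
  and inj_B_closed [simp] = linear_maps_closed[OF inj_B_linear]
  and inj_H_closed [simp] = linear_maps_closed[OF inj_H_linear]

lemma proj_B_pure [simp]: "b \<in> carrier B \<Longrightarrow> h \<in> carrier H \<Longrightarrow>
    proj_B H B (pure K B H b h) = counit H h \<odot>\<^bsub>B\<^esub> b"
  unfolding proj_B_def by (subst tsum_pure[OF _ _ _ proj_B_bilinear]) simp_all

lemma proj_H_pure [simp]: "b \<in> carrier B \<Longrightarrow> h \<in> carrier H \<Longrightarrow>
    proj_H H B (pure K B H b h) = counit B b \<odot>\<^bsub>H\<^esub> h"
  unfolding proj_H_def by (subst tsum_pure[OF _ _ _ proj_H_bilinear]) simp_all

lemma proj_B_inj_B [simp]: "b \<in> carrier B \<Longrightarrow> proj_B H B (inj_B K H B b) = b"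
  by (simp add: inj_B_def)

lemma proj_H_inj_B: "b \<in> carrier B \<Longrightarrow> proj_H H B (inj_B K H B b) = counit B b \<odot>\<^bsub>H\<^esub> \<one>\<^bsub>H\<^esub>"
  by (simp add: inj_B_def)

lemma proj_H_inj_H [simp]: "h \<in> carrier H \<Longrightarrow> proj_H H B (inj_H K H B h) = h"
  by (simp add: inj_H_def)

lemmas biproduct_linear_rules = linear_rules
  linear_comp[OF proj_B_linear] linear_comp[OF proj_H_linear]
  linear_comp[OF inj_B_linear] linear_comp[OF inj_H_linear]

section \<open>The coproduct of the biproduct\<close>

lemma biproduct_simps [simp]:
  "carrier A = carrier T" "zero A = zero T" "add A = add T" "smult A = smult T"
  by (simp_all add: biproduct_def Let_def)

lemma comult_biproduct_bilinear:
  "(\<lambda>b h. tsum TT (comult B b) (\<lambda>b1 b2. tsum TT (coact b2) (\<lambda>b2m b20.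
      tsum TT (comult H h) (\<lambda>h1 h2.
        pure K T T (pure K B H b1 (b2m \<otimes>\<^bsub>H\<^esub> h1)) (pure K B H b20 h2)))))
    \<in> bilinear_maps K B H TT"
  by (rule linear_rules | simp)+

lemma comult_biproduct_linear: "comult A \<in> linear_maps K T TT"
  using comult_biproduct_bilinear
  by (simp add: biproduct_def Let_def tsum_linear)

lemma comult_biproduct_pure:
  assumes "b \<in> carrier B" "h \<in> carrier H"
  shows "comult A (pure K B H b h) =
    tsum TT (comult B b) (\<lambda>b1 b2. tsum TT (coact b2) (\<lambda>b2m b20.
      tsum TT (comult H h) (\<lambda>h1 h2.
        pure K T T (pure K B H b1 (b2m \<otimes>\<^bsub>H\<^esub> h1)) (pure K B H b20 h2))))"
  using tsum_pure[OF _ _ _ comult_biproduct_bilinear] assms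
  by (simp add: biproduct_def Let_def)

lemma coalgebras: "k_coalgebra K H" "k_coalgebra K B"
  using k_coalgebra_axioms B.k_coalgebra_axioms by auto

lemma coact_counit_linear:
  assumes "module K U" "f \<in> linear_maps K B U" "b \<in> carrier B"
  shows "tsum U (coact b) (\<lambda>bm b0. counit H bm \<odot>\<^bsub>U\<^esub> f b0) = f b"
proof -
  have "f (tsum B (coact b) (\<lambda>bm b0. counit H bm \<odot>\<^bsub>B\<^esub> b0)) =
      tsum U (coact b) (\<lambda>bm b0. f (counit H bm \<odot>\<^bsub>B\<^esub> b0))"
    by (rule tsum_map_linear[OF modules(1,2,2) assms(1,2)]) (use assms in simp_all)
  also have "\<dots> = tsum U (coact b) (\<lambda>bm b0. counit H bm \<odot>\<^bsub>U\<^esub> f b0)"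
    by (rule tsum_cong[OF modules(1,2) assms(1)]) (use assms in \<open>simp_all add: linear_maps_smult\<close>)
  finally show ?thesis using coact_counit[OF assms(3)] by simp
qed

lemma coact_counit_comodule_linear:
  assumes "module K U" "f \<in> linear_maps K H U" "b \<in> carrier B"
  shows "tsum U (coact b) (\<lambda>bm b0. counit B b0 \<odot>\<^bsub>U\<^esub> f bm) = counit B b \<odot>\<^bsub>U\<^esub> f \<one>\<^bsub>H\<^esub>"
proof -
  have "f (tsum H (coact b) (\<lambda>bm b0. counit B b0 \<odot>\<^bsub>H\<^esub> bm)) =
      tsum U (coact b) (\<lambda>bm b0. f (counit B b0 \<odot>\<^bsub>H\<^esub> bm))"
    by (rule tsum_map_linear[OF modules(1,2,1) assms(1,2)]) (use assms in simp_all)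
  also have "\<dots> = tsum U (coact b) (\<lambda>bm b0. counit B b0 \<odot>\<^bsub>U\<^esub> f bm)"
    by (rule tsum_cong[OF modules(1,2) assms(1)]) (use assms in \<open>simp_all add: linear_maps_smult\<close>)
  finally show ?thesis
    using coact_counit_comodule[OF assms(3)] assms by (simp add: linear_maps_smult)
qed

text \<open>
  The coproduct of the biproduct is only used through the sums taken over it. On the two factors
  the general formula collapses, because the unit of the other factor is grouplike, and coinvariant
  when it is the unit of \<open>B\<close>.
\<close>

lemma tsum_comult_pure:
  assumes U: "module K U" and \<gamma>: "\<gamma> \<in> bilinear_maps K T T U"
    and b: "b \<in> carrier B" and h: "h \<in> carrier H"
  shows "tsum U (comult A (pure K B H b h)) \<gamma> =
    tsum U (comult B b) (\<lambda>b1 b2. tsum U (coact b2) (\<lambda>b2m b20.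
      tsum U (comult H h) (\<lambda>h1 h2.
        \<gamma> (pure K B H b1 (b2m \<otimes>\<^bsub>H\<^esub> h1)) (pure K B H b20 h2))))"
proof -
  note tsum_tsum_\<gamma> = tsum_tsum[where P = T and Q = T and \<gamma> = \<gamma> and U = U]
  have 1: "tsum U (tsum TT (comult H h) (\<lambda>h1 h2.
        pure K T T (pure K B H b1 (b2m \<otimes>\<^bsub>H\<^esub> h1)) (pure K B H b20 h2))) \<gamma> =
      tsum U (comult H h) (\<lambda>h1 h2.
        \<gamma> (pure K B H b1 (b2m \<otimes>\<^bsub>H\<^esub> h1)) (pure K B H b20 h2))"
    if "b1 \<in> carrier B" "b2m \<in> carrier H" "b20 \<in> carrier B" for b1 b2m b20
    using that U \<gamma> h
    by (subst tsum_tsum_\<gamma>[where V = H and W = H])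
      (auto intro!: tsum_cong[where V = H and W = H and K = K] simp: tsum_pure)
  have 2: "tsum U (tsum TT (coact b2) (\<lambda>b2m b20. tsum TT (comult H h) (\<lambda>h1 h2.
        pure K T T (pure K B H b1 (b2m \<otimes>\<^bsub>H\<^esub> h1)) (pure K B H b20 h2)))) \<gamma> =
      tsum U (coact b2) (\<lambda>b2m b20. tsum U (comult H h) (\<lambda>h1 h2.
        \<gamma> (pure K B H b1 (b2m \<otimes>\<^bsub>H\<^esub> h1)) (pure K B H b20 h2)))"
    if "b1 \<in> carrier B" "b2 \<in> carrier B" for b1 b2
    using that U \<gamma> h
    by (subst tsum_tsum_\<gamma>[where V = H and W = B])
      (auto intro!: tsum_cong[where V = H and W = B and K = K]
        tsum_closed[where V = H and W = H and K = K] simp: 1)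
  show ?thesis
    unfolding comult_biproduct_pure[OF b h] using U \<gamma> h b
    by (subst tsum_tsum_\<gamma>[where V = B and W = B])
      (auto intro!: tsum_cong[where V = B and W = B and K = K]
        tsum_closed[where V = H and W = H and K = K]
        tsum_closed[where V = H and W = B and K = K] simp: 2)
qed

lemma tsum_comult_inj_B:
  assumes U: "module K U" and \<gamma>: "\<gamma> \<in> bilinear_maps K T T U" and b: "b \<in> carrier B"
  shows "tsum U (comult A (inj_B K H B b)) \<gamma> =
    tsum U (comult B b) (\<lambda>b1 b2. tsum U (coact b2) (\<lambda>b2m b20.
      \<gamma> (pure K B H b1 b2m) (inj_B K H B b20)))"
proof -
  have bil: "(\<lambda>h1 h2. \<gamma> (pure K B H b1 (b2m \<otimes>\<^bsub>H\<^esub> h1)) (pure K B H b20 h2)) \<in> bilinear_maps K H H U"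
    if "b1 \<in> carrier B" "b2m \<in> carrier H" "b20 \<in> carrier B" for b1 b2m b20
    by (insert that U) (rule bilinear_mapsI bilinear_left[OF \<gamma>] bilinear_right[OF \<gamma>] linear_rules | simp)+
  show ?thesis
    unfolding inj_B_def using b
    by (auto simp: tsum_comult_pure[OF U \<gamma>] comult_H_one tsum_pure[OF _ _ U bil]
      intro!: tsum_cong[where V = B and W = B and K = K] tsum_cong[where V = H and W = B and K = K] U)
qed

lemma tsum_comult_inj_H:
  assumes U: "module K U" and \<gamma>: "\<gamma> \<in> bilinear_maps K T T U" and h: "h \<in> carrier H"
  shows "tsum U (comult A (inj_H K H B h)) \<gamma> =
    tsum U (comult H h) (\<lambda>h1 h2. \<gamma> (inj_H K H B h1) (inj_H K H B h2))"
proof -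
  note rules = bilinear_mapsI bilinear_left[OF \<gamma>] bilinear_right[OF \<gamma>] linear_rules
  have bil1: "(\<lambda>b1 b2. tsum U (coact b2) (\<lambda>b2m b20. tsum U (comult H h) (\<lambda>h1 h2.
      \<gamma> (pure K B H b1 (b2m \<otimes>\<^bsub>H\<^esub> h1)) (pure K B H b20 h2)))) \<in> bilinear_maps K B B U"
    by (insert U h) (rule rules | simp)+
  have bil2: "(\<lambda>b2m b20. tsum U (comult H h) (\<lambda>h1 h2.
      \<gamma> (pure K B H \<one>\<^bsub>B\<^esub> (b2m \<otimes>\<^bsub>H\<^esub> h1)) (pure K B H b20 h2))) \<in> bilinear_maps K H B U"
    by (insert U h) (rule rules | simp)+
  show ?thesis
    unfolding inj_H_def using h
    by (auto simp: tsum_comult_pure[OF U \<gamma>] comult_B_one tsum_pure[OF _ _ U bil1] coact_one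
      tsum_pure[OF _ _ U bil2] intro!: tsum_cong[where V = H and W = H and K = K] U)
qed

lemma reassemble_bilinear:
  "(\<lambda>x y. pure K B H (proj_B H B x) (proj_H H B y)) \<in> bilinear_maps K T T T"
  by (rule biproduct_linear_rules | simp)+

text \<open>
  The identity \<open>X = \<Pi>(X\<^sub>1) \<times> \<pi>(X\<^sub>2)\<close>. Both sides are linear, so \<open>X = b \<times> h\<close> may be
  assumed. There the right hand side carries the counits of \<open>h\<^sub>1\<close> and of both components of the
  coaction on \<open>b\<^sub>2\<close>. Contracting \<open>h\<^sub>1\<close>, then the \<open>H\<close>-component of the coaction, leaves the counit
  of \<open>b\<^sub>2\<close>, which is contracted last.
\<close>

lemma reassemble:
  assumes "X \<in> carrier T"
  shows "tsum T (comult A X) (\<lambda>x y. pure K B H (proj_B H B x) (proj_H H B y)) = X"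
proof -
  let ?\<delta> = "\<lambda>x y. pure K B H (proj_B H B x) (proj_H H B y)"
  have H_sum: "tsum T (comult H h) (\<lambda>h1 h2. ?\<delta> (pure K B H b1 (b2m \<otimes>\<^bsub>H\<^esub> h1)) (pure K B H b20 h2)) =
      counit H b2m \<odot>\<^bsub>T\<^esub> (counit B b20 \<odot>\<^bsub>T\<^esub> pure K B H b1 h)" (is "?l = ?r")
    if "h \<in> carrier H" "b1 \<in> carrier B" "b2m \<in> carrier H" "b20 \<in> carrier B" for h b1 b2m b20
  proof -
    let ?f = "\<lambda>z. counit H b2m \<odot>\<^bsub>T\<^esub> (counit B b20 \<odot>\<^bsub>T\<^esub> pure K B H b1 z)"
    interpret T: module K T by simp
    have "?l = tsum T (comult H h) (\<lambda>h1 h2. counit H h1 \<odot>\<^bsub>T\<^esub> ?f h2)"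
      using that
      by (intro tsum_cong[where V = H and W = H and K = K])
        (simp_all add: pure_smult_left pure_smult_right T.smult_assoc1[symmetric] m_ac)
    also have "\<dots> = ?r"
      by (rule coalgebra_counit_left_linear[where f = ?f, OF coalgebras(1)])
        (insert that, (rule linear_rules | simp)+)
    finally show ?thesis .
  qed
  have on_pure: "tsum T (comult A (pure K B H b h)) ?\<delta> = pure K B H b h"
    if "b \<in> carrier B" "h \<in> carrier H" for b h
  proof -
    have coact_sum: "tsum T (coact b2) (\<lambda>b2m b20. counit H b2m \<odot>\<^bsub>T\<^esub> (counit B b20 \<odot>\<^bsub>T\<^esub> pure K B H b1 h)) =
        counit B b2 \<odot>\<^bsub>T\<^esub> pure K B H b1 h" if "b1 \<in> carrier B" "b2 \<in> carrier B" for b1 b2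
      by (rule coact_counit_linear) (insert that \<open>h \<in> carrier H\<close>, (rule linear_rules | simp)+)
    have "tsum T (comult A (pure K B H b h)) ?\<delta> =
        tsum T (comult B b) (\<lambda>b1 b2. counit B b2 \<odot>\<^bsub>T\<^esub> pure K B H b1 h)"
      unfolding tsum_comult_pure[OF module_tensor[OF modules(2,1)] reassemble_bilinear that]
    proof (rule tsum_cong[where V = B and W = B and K = K])
      fix b1 b2 assume b12: "b1 \<in> carrier B" "b2 \<in> carrier B"
      have "tsum T (coact b2) (\<lambda>b2m b20. tsum T (comult H h) (\<lambda>h1 h2.
            ?\<delta> (pure K B H b1 (b2m \<otimes>\<^bsub>H\<^esub> h1)) (pure K B H b20 h2))) =
          tsum T (coact b2) (\<lambda>b2m b20. counit H b2m \<odot>\<^bsub>T\<^esub> (counit B b20 \<odot>\<^bsub>T\<^esub> pure K B H b1 h))"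
        by (rule tsum_cong[where V = H and W = B and K = K]) (use b12 that in \<open>simp_all only: H_sum coact_closed modules module_tensor\<close>)
      then show "tsum T (coact b2) (\<lambda>b2m b20. tsum T (comult H h) (\<lambda>h1 h2.
            ?\<delta> (pure K B H b1 (b2m \<otimes>\<^bsub>H\<^esub> h1)) (pure K B H b20 h2))) =
          counit B b2 \<odot>\<^bsub>T\<^esub> pure K B H b1 h"
        using coact_sum[OF b12] by simp
    qed (use that in simp_all)
    also have "\<dots> = pure K B H b h"
      by (rule coalgebra_counit_right_linear[OF coalgebras(2)])
        (insert that, (rule linear_rules | simp)+)
    finally show ?thesis .
  qed
  have linear: "(\<lambda>X. tsum T (comult A X) ?\<delta>) \<in> linear_maps K T T"
    by (rule linear_tsum_argument[where V = T and W = T])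
      (simp_all add: reassemble_bilinear comult_biproduct_linear)
  show ?thesis
    by (rule tensor_linear_ext[OF modules(2,1) module_tensor[OF modules(2,1)] linear linear_id
          on_pure assms])
qed

section \<open>The product of the biproduct\<close>

lemma mult_inner_bilinear:
  assumes "b \<in> carrier B" "h \<in> carrier H"
  shows "(\<lambda>b' h'. tsum T (comult H h) (\<lambda>h1 h2.
    pure K B H (b \<otimes>\<^bsub>B\<^esub> act h1 b') (h2 \<otimes>\<^bsub>H\<^esub> h'))) \<in> bilinear_maps K B H T"
  by (insert assms) (rule linear_rules | simp)+

lemma mult_outer_bilinear:
  assumes "Y \<in> carrier T"
  shows "(\<lambda>b h. tsum T Y (\<lambda>b' h'. tsum T (comult H h) (\<lambda>h1 h2.
    pure K B H (b \<otimes>\<^bsub>B\<^esub> act h1 b') (h2 \<otimes>\<^bsub>H\<^esub> h')))) \<in> bilinear_maps K B H T"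
  by (rule linear_rules assms | simp)+

lemma mult_biproduct: "mult A X Y = tsum T X (\<lambda>b h. tsum T Y (\<lambda>b' h'.
    tsum T (comult H h) (\<lambda>h1 h2. pure K B H (b \<otimes>\<^bsub>B\<^esub> act h1 b') (h2 \<otimes>\<^bsub>H\<^esub> h'))))"
  by (simp add: biproduct_def Let_def)

text \<open>
  The unit of \<open>H\<close> is grouplike and acts trivially, so left multiplication by \<open>J(b)\<close> only affects the
  \<open>B\<close>-component. In particular \<open>\<Pi>\<close> is left \<open>B\<close>-linear.
\<close>

lemma inj_B_mult:
  assumes "b \<in> carrier B" "X \<in> carrier T"
  shows "inj_B K H B b \<otimes>\<^bsub>A\<^esub> X = tsum T X (\<lambda>b' h'. pure K B H (b \<otimes>\<^bsub>B\<^esub> b') h')"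
proof -
  have bil: "(\<lambda>h1 h2. pure K B H (b \<otimes>\<^bsub>B\<^esub> act h1 b') (h2 \<otimes>\<^bsub>H\<^esub> h')) \<in> bilinear_maps K H H T"
    if "b' \<in> carrier B" "h' \<in> carrier H" for b' h'
    by (insert assms that) (rule linear_rules | simp)+
  show ?thesis
    using assms
    by (simp add: mult_biproduct inj_B_def tsum_pure[OF _ _ _ mult_outer_bilinear] comult_H_one)
      (rule tsum_cong[where V = B and W = H and K = K], simp_all add: tsum_pure[OF _ _ _ bil] act_one)
qed

lemma inj_B_mult_pure:
  assumes "b \<in> carrier B" "b' \<in> carrier B" "h \<in> carrier H"
  shows "inj_B K H B b \<otimes>\<^bsub>A\<^esub> pure K B H b' h = pure K B H (b \<otimes>\<^bsub>B\<^esub> b') h"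
proof -
  have bil: "(\<lambda>b' h'. pure K B H (b \<otimes>\<^bsub>B\<^esub> b') h') \<in> bilinear_maps K B H T"
    by (insert assms) (rule linear_rules | simp)+
  show ?thesis using assms by (simp add: inj_B_mult tsum_pure[OF _ _ _ bil])
qed

lemma proj_B_inj_B_mult:
  assumes "b \<in> carrier B" "X \<in> carrier T"
  shows "proj_B H B (inj_B K H B b \<otimes>\<^bsub>A\<^esub> X) = b \<otimes>\<^bsub>B\<^esub> proj_B H B X"
proof -
  have lin: "(\<lambda>c. b \<otimes>\<^bsub>B\<^esub> c) \<in> linear_maps K B B"
    by (insert assms) (rule linear_rules | simp)+
  have "proj_B H B (inj_B K H B b \<otimes>\<^bsub>A\<^esub> X) =
      tsum B X (\<lambda>b' h'. proj_B H B (pure K B H (b \<otimes>\<^bsub>B\<^esub> b') h'))"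
    unfolding inj_B_mult[OF assms]
    by (rule tsum_map_linear[where V = B and W = H, OF _ _ _ _ proj_B_linear]) (use assms in simp_all)
  also have "\<dots> = tsum B X (\<lambda>b' h'. b \<otimes>\<^bsub>B\<^esub> (counit H h' \<odot>\<^bsub>B\<^esub> b'))"
    by (rule tsum_cong[where V = B and W = H and K = K])
      (use assms in \<open>simp_all add: B.smult_mult_right\<close>)
  also have "\<dots> = b \<otimes>\<^bsub>B\<^esub> proj_B H B X"
    unfolding proj_B_def
    by (rule tsum_map_linear[where V = B and W = H, OF _ _ _ _ lin, symmetric]) (use assms in simp_all)
  finally show ?thesis .
qed

lemma mult_inj_B:
  assumes "c \<in> carrier B" "X \<in> carrier T"
  shows "X \<otimes>\<^bsub>A\<^esub> inj_B K H B c =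
    tsum T X (\<lambda>b h. tsum T (comult H h) (\<lambda>h1 h2. pure K B H (b \<otimes>\<^bsub>B\<^esub> act h1 c) h2))"
  unfolding mult_biproduct inj_B_def
  by (rule tsum_cong[where V = B and W = H and K = K])
    (use assms in \<open>simp_all add: tsum_pure[OF _ _ _ mult_inner_bilinear]
      tsum_cong[where V = H and W = H and K = K and \<beta> = "\<lambda>h1 h2. pure K B H (b \<otimes>\<^bsub>B\<^esub> act h1 c) (h2 \<otimes>\<^bsub>H\<^esub> \<one>\<^bsub>H\<^esub>)"
        and \<beta>' = "\<lambda>h1 h2. pure K B H (b \<otimes>\<^bsub>B\<^esub> act h1 c) h2" for b]\<close>)

lemma inj_H_mult_inj_B:
  assumes "b \<in> carrier B" "h \<in> carrier H"
  shows "inj_H K H B h \<otimes>\<^bsub>A\<^esub> inj_B K H B b = tsum T (comult H h) (\<lambda>h1 h2. pure K B H (act h1 b) h2)"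
proof -
  have bil: "(\<lambda>a h. tsum T (comult H h) (\<lambda>h1 h2. pure K B H (a \<otimes>\<^bsub>B\<^esub> act h1 b) h2)) \<in> bilinear_maps K B H T"
    by (insert assms) (rule linear_rules | simp)+
  show ?thesis
    using assms
    by (simp add: mult_inj_B) (simp add: inj_H_def tsum_pure[OF _ _ _ bil],
      rule tsum_cong[where V = H and W = H and K = K], simp_all)
qed

text \<open>
  On the right, multiplication by \<open>J(c)\<close> twists \<open>c\<close> by the \<open>H\<close>-component; of the split component
  \<open>h\<^sub>1 \<otimes> h\<^sub>2\<close> the map \<open>\<Pi>\<close> removes \<open>h\<^sub>2\<close>.
\<close>

lemma proj_B_mult_inj_B:
  assumes "c \<in> carrier B" "X \<in> carrier T"
  shows "proj_B H B (X \<otimes>\<^bsub>A\<^esub> inj_B K H B c) = tsum B X (\<lambda>b h. b \<otimes>\<^bsub>B\<^esub> act h c)"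
proof -
  have inner: "proj_B H B (tsum T (comult H h) (\<lambda>h1 h2. pure K B H (b \<otimes>\<^bsub>B\<^esub> act h1 c) h2)) =
      b \<otimes>\<^bsub>B\<^esub> act h c" if "b \<in> carrier B" "h \<in> carrier H" for b h
  proof -
    have "proj_B H B (tsum T (comult H h) (\<lambda>h1 h2. pure K B H (b \<otimes>\<^bsub>B\<^esub> act h1 c) h2)) =
        tsum B (comult H h) (\<lambda>h1 h2. proj_B H B (pure K B H (b \<otimes>\<^bsub>B\<^esub> act h1 c) h2))"
      by (rule tsum_map_linear[where V = H and W = H, OF _ _ _ _ proj_B_linear]) (use assms that in simp_all)
    also have "\<dots> = tsum B (comult H h) (\<lambda>h1 h2. counit H h2 \<odot>\<^bsub>B\<^esub> (b \<otimes>\<^bsub>B\<^esub> act h1 c))"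
      by (rule tsum_cong[where V = H and W = H and K = K]) (use assms that in simp_all)
    also have "\<dots> = b \<otimes>\<^bsub>B\<^esub> act h c"
      by (rule coalgebra_counit_right_linear[OF coalgebras(1)])
        (insert assms that, (rule linear_rules | simp)+)
    finally show ?thesis .
  qed
  have "proj_B H B (X \<otimes>\<^bsub>A\<^esub> inj_B K H B c) = tsum B X (\<lambda>b h.
      proj_B H B (tsum T (comult H h) (\<lambda>h1 h2. pure K B H (b \<otimes>\<^bsub>B\<^esub> act h1 c) h2)))"
    unfolding mult_inj_B[OF assms]
    by (rule tsum_map_linear[where V = B and W = H, OF _ _ _ _ proj_B_linear])
      (use assms in \<open>auto intro!: tsum_closed[where V = H and W = H and K = K]\<close>)
  also have "\<dots> = tsum B X (\<lambda>b h. b \<otimes>\<^bsub>B\<^esub> act h c)"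
    by (rule tsum_cong[where V = B and W = H and K = K]) (use assms inner in simp_all)
  finally show ?thesis .
qed

lemma counit_inj_B:
  assumes "b \<in> carrier B"
  shows "counit A (inj_B K H B b) = counit B b"
proof -
  have bil: "(\<lambda>b h. counit B b \<otimes>\<^bsub>K\<^esub> counit H h) \<in> bilinear_maps K B H (base K)"
    by (rule linear_rules | simp)+
  show ?thesis
    using assms by (simp add: biproduct_def Let_def inj_B_def tsum_pure[OF _ _ _ bil])
qed

section \<open>The coproduct and the coaction of B inside the biproduct\<close>

text \<open>
  The coproduct and the coaction of \<open>B\<close> are the images of \<open>\<Delta>(J(b))\<close> under \<open>\<Pi> \<otimes> \<Pi>\<close> and \<open>\<pi> \<otimes> \<Pi>\<close>.
  This is how a statement about the coproduct of the biproduct is carried over to \<open>B\<close>.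
\<close>

lemma comult_via_biproduct:
  assumes b: "b \<in> carrier B"
  shows "comult B b = tsum (tensor K B B) (comult A (inj_B K H B b))
    (\<lambda>x y. pure K B B (proj_B H B x) (proj_B H B y))"
proof -
  have bil: "(\<lambda>x y. pure K B B (proj_B H B x) (proj_B H B y)) \<in> bilinear_maps K T T (tensor K B B)"
    by (rule biproduct_linear_rules | simp)+
  have inner: "tsum (tensor K B B) (coact b2) (\<lambda>b2m b20.
      pure K B B (proj_B H B (pure K B H b1 b2m)) (proj_B H B (inj_B K H B b20))) = pure K B B b1 b2"
    (is "?l = _") if "b1 \<in> carrier B" "b2 \<in> carrier B" for b1 b2
  proof -
    have "?l = tsum (tensor K B B) (coact b2) (\<lambda>b2m b20.
        counit H b2m \<odot>\<^bsub>tensor K B B\<^esub> pure K B B b1 b20)"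
      by (rule tsum_cong[where V = H and W = B and K = K])
        (use that in \<open>simp_all add: pure_smult_left\<close>)
    also have "\<dots> = pure K B B b1 b2"
      by (rule coact_counit_linear) (insert that, (rule linear_rules | simp)+)
    finally show ?thesis .
  qed
  have "tsum (tensor K B B) (comult A (inj_B K H B b))
      (\<lambda>x y. pure K B B (proj_B H B x) (proj_B H B y)) = tsum (tensor K B B) (comult B b) (pure K B B)"
    unfolding tsum_comult_inj_B[OF module_tensor[OF modules(2,2)] bil b]
    by (rule tsum_cong[where V = B and W = B and K = K]) (use b inner in simp_all)
  also have "\<dots> = comult B b" using b by (intro tsum_pure_id) simp_all
  finally show ?thesis by simp
qed

text \<open>
  Since \<open>\<pi>(b\<^sub>1 \<times> h) = \<epsilon>(b\<^sub>1) h\<close>, applying \<open>\<pi>\<close> to the first component of \<open>\<Delta>(J(b))\<close> leaves only the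
  coaction. The map \<open>f\<close> on the second component stands both for \<open>\<Pi>\<close> and for \<open>\<Pi> \<circ> F\<close>.
\<close>

lemma proj_H_coaction:
  assumes b: "b \<in> carrier B" and f: "f \<in> linear_maps K T B"
  shows "tsum (tensor K H B) (comult A (inj_B K H B b)) (\<lambda>x y. pure K H B (proj_H H B x) (f y)) =
    tsum (tensor K H B) (coact b) (\<lambda>bm b0. pure K H B bm (f (inj_B K H B b0)))"
proof -
  note f_closed = linear_maps_closed[OF f]
  have bil: "(\<lambda>x y. pure K H B (proj_H H B x) (f y)) \<in> bilinear_maps K T T (tensor K H B)"
    by (rule biproduct_linear_rules linear_comp[OF f] | simp add: f_closed)+
  have bil': "(\<lambda>bm b0. pure K H B bm (f (inj_B K H B b0))) \<in> bilinear_maps K H B (tensor K H B)"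
    by (rule biproduct_linear_rules linear_comp[OF f] | simp add: f_closed)+
  have "tsum (tensor K H B) (comult A (inj_B K H B b)) (\<lambda>x y. pure K H B (proj_H H B x) (f y)) =
      tsum (tensor K H B) (comult B b) (\<lambda>b1 b2. counit B b1 \<odot>\<^bsub>tensor K H B\<^esub>
        tsum (tensor K H B) (coact b2) (\<lambda>bm b0. pure K H B bm (f (inj_B K H B b0))))"
    unfolding tsum_comult_inj_B[OF module_tensor[OF modules(1,2)] bil b]
  proof (rule tsum_cong[where V = B and W = B and K = K])
    fix b1 b2 assume b12: "b1 \<in> carrier B" "b2 \<in> carrier B"
    have lin: "(\<lambda>X. counit B b1 \<odot>\<^bsub>tensor K H B\<^esub> X) \<in> linear_maps K (tensor K H B) (tensor K H B)"
      by (insert b12) (rule linear_rules | simp)+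
    have "tsum (tensor K H B) (coact b2) (\<lambda>b2m b20.
          pure K H B (proj_H H B (pure K B H b1 b2m)) (f (inj_B K H B b20))) =
        tsum (tensor K H B) (coact b2) (\<lambda>bm b0.
          counit B b1 \<odot>\<^bsub>tensor K H B\<^esub> pure K H B bm (f (inj_B K H B b0)))"
      by (rule tsum_cong[where V = H and W = B and K = K])
        (use b12 in \<open>simp_all add: pure_smult_left f_closed\<close>)
    also have "\<dots> = counit B b1 \<odot>\<^bsub>tensor K H B\<^esub>
        tsum (tensor K H B) (coact b2) (\<lambda>bm b0. pure K H B bm (f (inj_B K H B b0)))"
      by (rule tsum_map_linear[where V = H and W = B, OF _ _ _ _ lin, symmetric]) (use b12 in \<open>simp_all add: f_closed\<close>)
    finally show "tsum (tensor K H B) (coact b2) (\<lambda>b2m b20.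
          pure K H B (proj_H H B (pure K B H b1 b2m)) (f (inj_B K H B b20))) =
        counit B b1 \<odot>\<^bsub>tensor K H B\<^esub>
          tsum (tensor K H B) (coact b2) (\<lambda>bm b0. pure K H B bm (f (inj_B K H B b0)))" .
  qed (use b in simp_all)
  also have "\<dots> = tsum (tensor K H B) (coact b) (\<lambda>bm b0. pure K H B bm (f (inj_B K H B b0)))"
    by (rule coalgebra_counit_left_linear[OF coalgebras(2)])
      (auto intro!: linear_tsum_argument[where V = H and W = B] coact_linear bil' b)
  finally show ?thesis .
qed

lemma coact_via_biproduct:
  assumes "b \<in> carrier B"
  shows "coact b = tsum (tensor K H B) (comult A (inj_B K H B b))
    (\<lambda>x y. pure K H B (proj_H H B x) (proj_B H B y))"
proof -
  have "tsum (tensor K H B) (coact b) (\<lambda>bm b0. pure K H B bm (proj_B H B (inj_B K H B b0))) =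
      tsum (tensor K H B) (coact b) (pure K H B)"
    by (rule tsum_cong[where V = H and W = B and K = K]) (use assms in simp_all)
  also have "\<dots> = coact b" using assms by (intro tsum_pure_id) simp_all
  finally show ?thesis using proj_H_coaction[OF assms proj_B_linear] by simp
qed

end

section \<open>Endomorphisms of the biproduct over H\<close>

text \<open>
  The biproduct and the tensor product underlying it are different records with the same vector
  space structure. This lemma identifies the tensor squares of the two.
\<close>

lemma tensor_eq_transfer:
  assumes "tensor_eq K V W x y"
    and V: "carrier V = carrier V'" "zero V = zero V'" "add V = add V'" "smult V = smult V'"
    and W: "carrier W = carrier W'" "zero W = zero W'" "add W = add W'" "smult W = smult W'"
  shows "tensor_eq K V' W' x y"
  using assms(1)
proof induction
  case (sym x y)
  then show ?case by (blast intro: tensor_eq.sym)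
next
  case (trans x y z)
  then show ?case by (blast intro: tensor_eq.trans)
qed (simp_all add: V W tensor_eq.refl tensor_eq.append tensor_eq.commute tensor_eq.zero
  tensor_eq.add_left tensor_eq.add_right tensor_eq.smult)

locale biproduct_endomorphism = biproduct_data K H B act coact
  for K (structure) and H (structure) and B (structure) and act and coact +
  fixes F
  assumes F: "F \<in> End_Hopf K H B act coact"
begin

abbreviation "FL \<equiv> left_part K H B F"
abbreviation "FR \<equiv> right_part K H B F"

lemma F_linear: "F \<in> linear_maps K T T"
proof -
  have "F \<in> linear_maps K A A"
    using F by (simp add: End_Hopf_def Let_def hopf_maps_def algebra_maps_def)
  then show ?thesis by (simp add: linear_maps_def)
qed

lemmas F_closed [simp] = linear_maps_closed[OF F_linear]

lemma F_mult: "X \<in> carrier T \<Longrightarrow> Y \<in> carrier T \<Longrightarrow> F (X \<otimes>\<^bsub>A\<^esub> Y) = F X \<otimes>\<^bsub>A\<^esub> F Y"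
  and F_one: "F \<one>\<^bsub>A\<^esub> = \<one>\<^bsub>A\<^esub>"
  and F_counit: "X \<in> carrier T \<Longrightarrow> counit A (F X) = counit A X"
  and F_proj_H: "X \<in> carrier T \<Longrightarrow> proj_H H B (F X) = proj_H H B X"
  using F by (simp_all add: End_Hopf_def Let_def hopf_maps_def algebra_maps_def ring_hom_def)

lemma F_comult:
  assumes "X \<in> carrier T"
  shows "comult A (F X) = tsum TT (comult A X) (\<lambda>x y. pure K T T (F x) (F y))"
proof -
  have class_A: "tensor_class K A A = tensor_class K T T"
    unfolding tensor_class_def
    by (intro ext Collect_cong iffI) (erule tensor_eq_transfer; simp)+
  have "comult A (F X) = tsum (tensor K A A) (comult A X) (\<lambda>x y. pure K A A (F x) (F y))"
    using F assms by (simp add: End_Hopf_def Let_def hopf_maps_def)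
  also have "\<dots> = tsum TT (comult A X) (\<lambda>x y. pure K T T (F x) (F y))"
    by (simp add: tsum_def pure_def tensor_def[of K A A] tensor_def[of K T T] class_A)
  finally show ?thesis .
qed

lemma tsum_comult_F:
  assumes U: "module K U" and \<gamma>: "\<gamma> \<in> bilinear_maps K T T U" and X: "X \<in> carrier T"
  shows "tsum U (comult A (F X)) \<gamma> = tsum U (comult A X) (\<lambda>x y. \<gamma> (F x) (F y))"
proof -
  have comult: "comult A X \<in> carrier TT"
    using X by (rule linear_maps_closed[OF comult_biproduct_linear])
  have "tsum U (comult A (F X)) \<gamma> =
      tsum U (comult A X) (\<lambda>x y. tsum U (pure K T T (F x) (F y)) \<gamma>)"
    unfolding F_comult[OF X]
    by (rule tsum_tsum[where V = T and W = T and K = K]) (use U \<gamma> comult in simp_all)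
  also have "\<dots> = tsum U (comult A X) (\<lambda>x y. \<gamma> (F x) (F y))"
    by (rule tsum_cong[where V = T and W = T and K = K]) (use U comult in \<open>simp_all add: tsum_pure[OF _ _ _ \<gamma>]\<close>)
  finally show ?thesis .
qed

lemma FL_linear: "FL \<in> linear_maps K B B"
  and FR_linear: "FR \<in> linear_maps K H B"
  unfolding left_part_def right_part_def comp_def
  by (rule biproduct_linear_rules linear_comp[OF F_linear] | simp)+

lemmas FL_closed [simp] = linear_maps_closed[OF FL_linear]
  and FR_closed [simp] = linear_maps_closed[OF FR_linear]

text \<open>
  The coproduct is preserved by \<open>F\<close> and \<open>\<pi> \<circ> F = \<pi>\<close>, so in the reassembly of \<open>F(X)\<close> the map \<open>F\<close>
  survives only in the first component.
\<close>

lemma F_reassemble: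
  assumes X: "X \<in> carrier T"
  shows "F X = tsum T (comult A X) (\<lambda>x y. pure K B H (proj_B H B (F x)) (proj_H H B y))"
proof -
  have comult: "comult A X \<in> carrier TT"
    using X by (rule linear_maps_closed[OF comult_biproduct_linear])
  have "F X = tsum T (comult A X) (\<lambda>x y. pure K B H (proj_B H B (F x)) (proj_H H B (F y)))"
    using reassemble[OF F_closed[OF X]] tsum_comult_F[OF _ reassemble_bilinear X] by simp
  also have "\<dots> = tsum T (comult A X) (\<lambda>x y. pure K B H (proj_B H B (F x)) (proj_H H B y))"
    by (rule tsum_cong[where V = T and W = T and K = K]) (use comult in \<open>simp_all add: F_proj_H\<close>)
  finally show ?thesis .
qed

lemma F_reassemble_bilinear:
  "(\<lambda>x y. pure K B H (proj_B H B (F x)) (proj_H H B y)) \<in> bilinear_maps K T T T"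
  by (rule biproduct_linear_rules linear_comp[OF F_linear] | simp)+

text \<open>
  The second component of \<open>\<Delta>(J(b))\<close> is \<open>J\<close> of the \<open>B\<close>-component of the coaction, and \<open>\<pi> \<circ> J = \<epsilon>\<close>.
  Contracting this counit leaves nothing but \<open>1\<close> in \<open>H\<close>: \<open>F\<close> maps the subalgebra \<open>J(B)\<close> to itself.
\<close>

lemma F_inj_B:
  assumes b: "b \<in> carrier B"
  shows "F (inj_B K H B b) = inj_B K H B (FL b)"
proof -
  have inner: "tsum T (coact b2) (\<lambda>b2m b20. pure K B H (proj_B H B (F (pure K B H b1 b2m)))
        (proj_H H B (inj_B K H B b20))) =
      counit B b2 \<odot>\<^bsub>T\<^esub> inj_B K H B (FL b1)" (is "?l = _")
    if "b1 \<in> carrier B" "b2 \<in> carrier B" for b1 b2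
  proof -
    let ?f = "\<lambda>z. pure K B H (proj_B H B (F (pure K B H b1 z))) \<one>\<^bsub>H\<^esub>"
    have lin: "?f \<in> linear_maps K H T"
      by (insert that) (rule biproduct_linear_rules linear_comp[OF F_linear] | simp)+
    have "?l = tsum T (coact b2) (\<lambda>bm b0. counit B b0 \<odot>\<^bsub>T\<^esub> ?f bm)"
      by (rule tsum_cong[where V = H and W = B and K = K])
        (use that in \<open>simp_all add: proj_H_inj_B pure_smult_right\<close>)
    also have "\<dots> = counit B b2 \<odot>\<^bsub>T\<^esub> ?f \<one>\<^bsub>H\<^esub>"
      by (rule coact_counit_comodule_linear) (simp_all add: lin that)
    finally show ?thesis by (simp add: inj_B_def left_part_def)
  qed
  have "F (inj_B K H B b) = tsum T (comult B b) (\<lambda>b1 b2. counit B b2 \<odot>\<^bsub>T\<^esub> inj_B K H B (FL b1))"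
    unfolding F_reassemble[OF inj_B_closed[OF b]]
      tsum_comult_inj_B[OF module_tensor[OF modules(2,1)] F_reassemble_bilinear b]
    by (rule tsum_cong[where V = B and W = B and K = K]) (use b inner in simp_all)
  also have "\<dots> = inj_B K H B (FL b)"
    by (rule coalgebra_counit_right_linear[OF coalgebras(2)])
      (insert b, (rule linear_comp[OF inj_B_linear] FL_linear | simp)+)
  finally show ?thesis .
qed

lemma F_inj_H:
  assumes h: "h \<in> carrier H"
  shows "F (inj_H K H B h) = tsum T (comult H h) (\<lambda>h1 h2. pure K B H (FR h1) h2)"
  unfolding F_reassemble[OF inj_H_closed[OF h]]
    tsum_comult_inj_H[OF module_tensor[OF modules(2,1)] F_reassemble_bilinear h]
  by (rule tsum_cong[where V = H and W = H and K = K])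
    (use h in \<open>simp_all add: right_part_def\<close>)

text \<open>Obtained from \<open>b \<times> h = J(b) j(h)\<close>, as \<open>F(J(b)) = J(F\<^sub>L(b))\<close> and \<open>\<Pi>\<close> is left \<open>B\<close>-linear.\<close>

lemma proj_B_F_pure:
  assumes "b \<in> carrier B" "h \<in> carrier H"
  shows "proj_B H B (F (pure K B H b h)) = FL b \<otimes>\<^bsub>B\<^esub> FR h"
proof -
  have "pure K B H b h = inj_B K H B b \<otimes>\<^bsub>A\<^esub> inj_H K H B h"
    using assms by (simp add: inj_H_def inj_B_mult_pure)
  then show ?thesis
    using assms by (simp add: F_mult F_inj_B proj_B_inj_B_mult right_part_def)
qed

lemma FL_algebra_map: "FL \<in> algebra_maps K B B"
proof -
  have one: "\<one>\<^bsub>A\<^esub> = inj_B K H B \<one>\<^bsub>B\<^esub>"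
    by (simp add: biproduct_def Let_def inj_B_def)
  have "FL (b \<otimes>\<^bsub>B\<^esub> b') = FL b \<otimes>\<^bsub>B\<^esub> FL b'" if "b \<in> carrier B" "b' \<in> carrier B" for b b'
  proof -
    have "inj_B K H B (b \<otimes>\<^bsub>B\<^esub> b') = inj_B K H B b \<otimes>\<^bsub>A\<^esub> inj_B K H B b'"
      using that inj_B_mult_pure[of b b' "\<one>\<^bsub>H\<^esub>"] by (simp add: inj_B_def)
    then show ?thesis
      using that by (simp add: left_part_def[of K H B F] F_mult)
        (simp add: F_inj_B proj_B_inj_B_mult)
  qed
  moreover have "FL \<one>\<^bsub>B\<^esub> = \<one>\<^bsub>B\<^esub>"
    using F_one by (simp add: left_part_def one)
  ultimately show ?thesis
    using FL_linear linear_maps_add[OF FL_linear]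
    by (auto simp: algebra_maps_def intro!: ring_hom_memI)
qed

lemma counit_FL: "b \<in> carrier B \<Longrightarrow> counit B (FL b) = counit B b"
  using counit_inj_B[of "FL b"] by (simp add: F_inj_B[symmetric] F_counit counit_inj_B)

lemma comult_FL:
  assumes b: "b \<in> carrier B"
  shows "comult B (FL b) = tsum (tensor K B B) (comult B b) (\<lambda>b1 b2.
    tsum (tensor K B B) (coact b2) (\<lambda>b2m b20. pure K B B (FL b1 \<otimes>\<^bsub>B\<^esub> FR b2m) (FL b20)))"
proof -
  have bil: "(\<lambda>x y. pure K B B (proj_B H B x) (proj_B H B y)) \<in> bilinear_maps K T T (tensor K B B)"
    by (rule biproduct_linear_rules | simp)+
  have bil_F: "(\<lambda>x y. pure K B B (proj_B H B (F x)) (proj_B H B (F y))) \<in> bilinear_maps K T T (tensor K B B)"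
    by (rule biproduct_linear_rules linear_comp[OF F_linear] | simp)+
  have "comult B (FL b) = tsum (tensor K B B) (comult A (inj_B K H B b))
      (\<lambda>x y. pure K B B (proj_B H B (F x)) (proj_B H B (F y)))"
    using b tsum_comult_F[OF _ bil]
    by (simp add: comult_via_biproduct[of "FL b"] F_inj_B[symmetric])
  also have "\<dots> = tsum (tensor K B B) (comult B b) (\<lambda>b1 b2. tsum (tensor K B B) (coact b2)
      (\<lambda>b2m b20. pure K B B (proj_B H B (F (pure K B H b1 b2m))) (proj_B H B (F (inj_B K H B b20)))))"
    by (rule tsum_comult_inj_B[OF _ bil_F b]) simp
  also have "\<dots> = tsum (tensor K B B) (comult B b) (\<lambda>b1 b2. tsum (tensor K B B) (coact b2)
      (\<lambda>b2m b20. pure K B B (FL b1 \<otimes>\<^bsub>B\<^esub> FR b2m) (FL b20)))"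
    by (intro tsum_cong[where V = B and W = B and K = K] tsum_cong[where V = H and W = B and K = K])
      (use b in \<open>simp_all add: proj_B_F_pure F_inj_B\<close>)
  finally show ?thesis .
qed

lemma coact_FL:
  assumes b: "b \<in> carrier B"
  shows "coact (FL b) = tsum (tensor K H B) (coact b) (\<lambda>bm b0. pure K H B bm (FL b0))"
proof -
  have comult: "comult A (inj_B K H B b) \<in> carrier TT"
    using b by (intro linear_maps_closed[OF comult_biproduct_linear]) simp
  have bil: "(\<lambda>x y. pure K H B (proj_H H B x) (proj_B H B y)) \<in> bilinear_maps K T T (tensor K H B)"
    by (rule biproduct_linear_rules | simp)+
  have "coact (FL b) = tsum (tensor K H B) (comult A (inj_B K H B b))
      (\<lambda>x y. pure K H B (proj_H H B (F x)) (proj_B H B (F y)))"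
    using b tsum_comult_F[OF _ bil]
    by (simp add: coact_via_biproduct[of "FL b"] F_inj_B[symmetric])
  also have "\<dots> = tsum (tensor K H B) (comult A (inj_B K H B b))
      (\<lambda>x y. pure K H B (proj_H H B x) (proj_B H B (F y)))"
    by (rule tsum_cong[where V = T and W = T and K = K]) (use comult in \<open>simp_all add: F_proj_H\<close>)
  also have "\<dots> = tsum (tensor K H B) (coact b)
      (\<lambda>bm b0. pure K H B bm (proj_B H B (F (inj_B K H B b0))))"
    by (rule proj_H_coaction[OF b linear_comp[OF proj_B_linear F_linear]])
  also have "\<dots> = tsum (tensor K H B) (coact b) (\<lambda>bm b0. pure K H B bm (FL b0))"
    by (simp add: left_part_def)
  finally show ?thesis .
qed

text \<open>
  Both sides are \<open>\<Pi>(F(j(h) J(b)))\<close>: on the left the product \<open>j(h) J(b)\<close> is expanded first, on the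
  right \<open>F\<close> is first distributed over it.
\<close>

lemma FL_FR_exchange:
  assumes h: "h \<in> carrier H" and b: "b \<in> carrier B"
  shows "tsum B (comult H h) (\<lambda>h1 h2. FL (act h1 b) \<otimes>\<^bsub>B\<^esub> FR h2) =
    tsum B (comult H h) (\<lambda>h1 h2. FR h1 \<otimes>\<^bsub>B\<^esub> act h2 (FL b))"
proof -
  have bil: "(\<lambda>a h. a \<otimes>\<^bsub>B\<^esub> act h (FL b)) \<in> bilinear_maps K B H B"
    by (insert b) (rule linear_rules | simp)+
  have "tsum B (comult H h) (\<lambda>h1 h2. FL (act h1 b) \<otimes>\<^bsub>B\<^esub> FR h2) =
      tsum B (comult H h) (\<lambda>h1 h2. proj_B H B (F (pure K B H (act h1 b) h2)))"
    by (rule tsum_cong[where V = H and W = H and K = K]) (use h b in \<open>simp_all add: proj_B_F_pure\<close>)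
  also have "\<dots> = proj_B H B (F (inj_H K H B h \<otimes>\<^bsub>A\<^esub> inj_B K H B b))"
    unfolding inj_H_mult_inj_B[OF b h]
    by (rule tsum_map_linear[where V = H and W = H, OF _ _ _ _ linear_comp[OF proj_B_linear F_linear], symmetric])
      (use h b in simp_all)
  also have "\<dots> = proj_B H B (F (inj_H K H B h) \<otimes>\<^bsub>A\<^esub> inj_B K H B (FL b))"
    using h b by (simp add: F_mult F_inj_B)
  also have "\<dots> = tsum B (F (inj_H K H B h)) (\<lambda>a h. a \<otimes>\<^bsub>B\<^esub> act h (FL b))"
    using h b by (intro proj_B_mult_inj_B) simp_all
  also have "\<dots> = tsum B (comult H h) (\<lambda>h1 h2. tsum B (pure K B H (FR h1) h2) (\<lambda>a h. a \<otimes>\<^bsub>B\<^esub> act h (FL b)))"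
    unfolding F_inj_H[OF h]
    by (rule tsum_tsum[where V = H and W = H and K = K]) (use h bil in simp_all)
  also have "\<dots> = tsum B (comult H h) (\<lambda>h1 h2. FR h1 \<otimes>\<^bsub>B\<^esub> act h2 (FL b))"
    by (rule tsum_cong[where V = H and W = H and K = K]) (use h in \<open>simp_all add: tsum_pure[OF _ _ _ bil]\<close>)
  finally show ?thesis .
qed

end

theorem lemma2:
  fixes K :: "('k, 'm) ring_scheme"
    and H :: "('k, 'h, 'p) coalg_scheme"
    and B :: "('k, 'b, 'q) coalg_scheme"
    and act :: "'h \<Rightarrow> 'b \<Rightarrow> 'b"
    and coact :: "'b \<Rightarrow> ('h, 'b) tensor"
    and F :: "('b, 'h) tensor \<Rightarrow> ('b, 'h) tensor"
  assumes "biproduct_data K H B act coact"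
    and "F \<in> End_Hopf K H B act coact"
  shows "left_part K H B F \<in> algebra_maps K B B
    \<and> (\<forall>b \<in> carrier B. counit B (left_part K H B F b) = counit B b)
    \<and> (\<forall>b \<in> carrier B. comult B (left_part K H B F b) =
        tsum (tensor K B B) (comult B b) (\<lambda>b1 b2.
          tsum (tensor K B B) (coact b2) (\<lambda>b2m b20.
            pure K B B (left_part K H B F b1 \<otimes>\<^bsub>B\<^esub> right_part K H B F b2m)
              (left_part K H B F b20))))
    \<and> (\<forall>b \<in> carrier B. coact (left_part K H B F b) =
        tsum (tensor K H B) (coact b) (\<lambda>bm b0. pure K H B bm (left_part K H B F b0)))
    \<and> (\<forall>h \<in> carrier H. \<forall>b \<in> carrier B.
        tsum B (comult H h) (\<lambda>h1 h2.
          left_part K H B F (act h1 b) \<otimes>\<^bsub>B\<^esub> right_part K H B F h2) =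
        tsum B (comult H h) (\<lambda>h1 h2.
          right_part K H B F h1 \<otimes>\<^bsub>B\<^esub> act h2 (left_part K H B F b)))"
proof -
  interpret biproduct_endomorphism K H B act coact F
    using assms by (intro biproduct_endomorphism.intro biproduct_endomorphism_axioms.intro)
  show ?thesis
    using FL_algebra_map counit_FL comult_FL coact_FL FL_FR_exchange by blast
qed

end
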